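(* Let $f,g\in XDBP$ and suppose $g=f^\sigma$ for some $\sigma\in\Gamma=\mathrm{Gal}(\overline{\mathbb{Q}}/\mathbb{Q})$. Then for all $n>0$ the monodromy groups $\mathrm{Mon}(f^{\circ n})$ and $\mathrm{Mon}(g^{\circ n})$ are permutation-isomorphic.
   Context: Fix an embedding $\overline{\mathbb{Q}}\subset\mathbb{C}$. For a polynomial $f$, $C_f$ is its set of critical points in $\mathbb{C}$ and $P_f=\overline{\bigcup_{n>0}f^{\circ n}(C_f)}$. $DBP$ is the set of polynomials $f\in\overline{\mathbb{Q}}[z]$ of degree at least $3$ whose critical values lie in $\{0,1\}$, having local degree exactly $2$ at every point of $f^{-1}(1)$, and with $P_f\subset\{0,1\}$. $XDBP$ is the set of $f\in DBP$ with $f(0)=f(1)=0$ and local degree one at both $0$ and $1$; it is closed under iteration. $f^\sigma$ is obtained from $f$ by applying $\sigma$ to its coefficients. For a polynomial $h$ with all critical values in $\{0,1\}$, $\mathrm{Mon}(h)$ is the monodromy group of the covering $h:\mathbb{C}\setminus h^{-1}(\{0,1\})\to\mathbb{C}\setminus\{0,1\}$, viewed as a permutation group on the fiber $h^{-1}(1/2)$, equivalently on the set $E_h$ of edges of the planar tree $h^{-1}([0,1])$ (the components of $h^{-1}((0,1))$). $\mathrm{Mon}(h_1)$ and $\mathrm{Mon}(h_2)$ are permutation-isomorphic if there is a bijection $\tau:E_{h_1}\to E_{h_2}$ with $\mathrm{Mon}(h_2)=\tau\,\mathrm{Mon}(h_1)\,\tau^{-1}$. *)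

theory Defs
  imports
    "HOL-Analysis.Analysis"
    "HOL-Computational_Algebra.Computational_Algebra"
    "HOL-Combinatorics.Permutations"
begin

definition Qbar :: "complex set"
  where "Qbar = {z. algebraic z}"

text \<open>
  Elements of \<open>Gal(Qbar/Q)\<close> are represented by functions on \<^typ>\<open>complex\<close>, of which only the
  values on \<^const>\<open>Qbar\<close> are constrained. These are the only values used when such a function is
  applied, by \<^const>\<open>map_poly\<close>, to the coefficients of a polynomial over \<^const>\<open>Qbar\<close>.
\<close>

definition Gal_Qbar :: "(complex \<Rightarrow> complex) set"
  where "Gal_Qbar =
    {\<sigma>. bij_betw \<sigma> Qbar Qbar \<and>
        (\<forall>x\<in>Qbar. \<forall>y\<in>Qbar. \<sigma> (x + y) = \<sigma> x + \<sigma> y) \<and>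
        (\<forall>x\<in>Qbar. \<forall>y\<in>Qbar. \<sigma> (x * y) = \<sigma> x * \<sigma> y) \<and>
        (\<forall>q\<in>\<rat>. \<sigma> q = q)}"

definition critical_points :: "complex poly \<Rightarrow> complex set"
  where "critical_points f = {c. poly (pderiv f) c = 0}"

definition postcritical_set :: "complex poly \<Rightarrow> complex set"
  where "postcritical_set f = closure (\<Union>n\<in>{0<..}. (poly f ^^ n) ` critical_points f)"

definition local_degree :: "complex poly \<Rightarrow> complex \<Rightarrow> nat"
  where "local_degree f z = order z (f - [:poly f z:])"

definition DBP :: "complex poly set"
  where "DBP =
    {f. (\<forall>i. coeff f i \<in> Qbar) \<and> degree f \<ge> 3 \<and>
        poly f ` critical_points f \<subseteq> {0, 1} \<and>
        (\<forall>z. poly f z = 1 \<longrightarrow> local_degree f z = 2) \<and>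
        postcritical_set f \<subseteq> {0, 1}}"

definition XDBP :: "complex poly set"
  where "XDBP =
    {f \<in> DBP. poly f 0 = 0 \<and> poly f 1 = 0 \<and> local_degree f 0 = 1 \<and> local_degree f 1 = 1}"

definition poly_iter :: "nat \<Rightarrow> complex poly \<Rightarrow> complex poly"
  where "poly_iter n f = (pcompose f ^^ n) [:0, 1:]"

text \<open>
  The monodromy group of a covering \<open>p : C \<rightarrow> S\<close>, acting on the fiber over \<open>b\<close>: a loop at \<open>b\<close>
  sends \<open>x\<close> to the endpoint of its lift starting at \<open>x\<close>. Since the set of loops is closed under
  reversal, the set of permutations does not depend on the order in which paths are composed.
\<close>

definition monodromy_group ::
    "'a::topological_space set \<Rightarrow> ('a \<Rightarrow> 'b::topological_space) \<Rightarrow> 'b set \<Rightarrow> 'b \<Rightarrow> ('a \<Rightarrow> 'a) set"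
  where "monodromy_group C p S b =
    {\<pi>. \<pi> permutes {x \<in> C. p x = b} \<and>
        (\<exists>\<gamma>. path \<gamma> \<and> path_image \<gamma> \<subseteq> S \<and> pathstart \<gamma> = b \<and> pathfinish \<gamma> = b \<and>
          (\<forall>x\<in>{x \<in> C. p x = b}. \<exists>\<delta>. path \<delta> \<and> path_image \<delta> \<subseteq> C \<and>
             (\<forall>t\<in>{0..1}. p (\<delta> t) = \<gamma> t) \<and> pathstart \<delta> = x \<and> pathfinish \<delta> = \<pi> x))}"

definition fiber_Mon :: "complex poly \<Rightarrow> (complex \<Rightarrow> complex) set"
  where "fiber_Mon h =
    monodromy_group (- (poly h -` {0, 1})) (poly h) (- {0, 1}) (1/2)"

definition edges :: "complex poly \<Rightarrow> complex set set"
  where "edges h = components (poly h -` open_segment 0 1)"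

text \<open>
  When the critical values of \<open>h\<close> lie in \<open>{0, 1}\<close>, every edge is mapped homeomorphically onto the
  open segment by \<open>h\<close> and so contains exactly one point of the fiber over \<open>1/2\<close>. \<open>Mon\<close> is
  \<^const>\<open>fiber_Mon\<close> transported along this bijection between the fiber and the edges.
\<close>

definition Mon :: "complex poly \<Rightarrow> (complex set \<Rightarrow> complex set) set"
  where "Mon h =
    {\<rho>. \<rho> permutes edges h \<and>
        (\<exists>\<pi>\<in>fiber_Mon h. \<forall>e\<in>edges h. \<forall>x\<in>e. poly h x = 1/2 \<longrightarrow> \<pi> x \<in> \<rho> e)}"

text \<open>
  Permutations of \<open>A\<close> are functions on the whole type that are the identity outside \<open>A\<close>
  (\<^const>\<open>permutes\<close>), hence the case distinction in the conjugate by \<open>\<tau> : A \<rightarrow> B\<close>.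
\<close>

definition conj_perm :: "'a set \<Rightarrow> 'b set \<Rightarrow> ('a \<Rightarrow> 'b) \<Rightarrow> ('a \<Rightarrow> 'a) \<Rightarrow> 'b \<Rightarrow> 'b"
  where "conj_perm A B \<tau> \<pi> = (\<lambda>y. if y \<in> B then \<tau> (\<pi> (inv_into A \<tau> y)) else y)"

definition perm_isomorphic ::
    "'a set \<Rightarrow> ('a \<Rightarrow> 'a) set \<Rightarrow> 'b set \<Rightarrow> ('b \<Rightarrow> 'b) set \<Rightarrow> bool"
  where "perm_isomorphic A G B H \<longleftrightarrow> (\<exists>\<tau>. bij_betw \<tau> A B \<and> H = conj_perm A B \<tau> ` G)"

end

theory Submission
  imports Defs "HOL-Complex_Analysis.Complex_Analysis"
begin

text \<open>
  Write \<open>h\<close> for the iterate of \<open>f\<close>; conjugation by \<open>\<sigma>\<close> itself, restricted to the fiber \<open>F\<close> of \<open>h\<close>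
  over \<open>1/2\<close>, is shown to carry the monodromy group of \<open>h\<close> to that of its conjugate. Path lifting
  identifies \<open>F\<close> with the nearby fibers, and this singles out, among all bijections \<open>\<phi>\<close> from \<open>F\<close> to
  the fiber over \<open>t\<close>, the set \<open>A t\<close> of those obtained by lifting a path from \<open>1/2\<close> to \<open>t\<close>. Choose
  rational \<open>a x\<close> such that \<open>\<phi> \<mapsto> \<Sum>x\<in>F. a x * \<phi> x\<close> is injective over \<open>t = 1/2\<close>, and consider the monic
  polynomial in \<open>T\<close> with these numbers, \<open>\<phi> \<in> A t\<close>, as its roots. Its coefficients are single-valued
  holomorphic functions of \<open>t\<close> off \<open>{0, 1}\<close> of polynomial growth, hence polynomials in \<open>t\<close>, and they
  are defined over \<open>Qbar\<close> because their values at rational \<open>t\<close> are algebraic. So \<open>\<sigma>\<close> can be applied to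
  them. The same holds for the complement of \<open>A t\<close>. The product of the two conjugated polynomials
  vanishes on the tuples of local branches of the inverse of the conjugate of \<open>h\<close>, at rational \<open>t\<close> near
  \<open>1/2\<close>; the second factor does not vanish at \<open>1/2\<close>, so the first one vanishes near \<open>1/2\<close> and, by
  analytic continuation, along every loop. At the end of the loop this says that the permutation of
  the conjugate fiber is the conjugate of an element of \<open>A (1/2)\<close>.
\<close>

section \<open>The field of algebraic numbers\<close>

interpretation rat_space: vector_space "\<lambda>(q::rat) (x::complex). of_rat q * x"
  by standard (auto simp: algebra_simps of_rat_add of_rat_mult)

text \<open>
  A ring that is finite-dimensional over \<open>\<rat>\<close> consists of algebraic numbers, since the powers of an
  element are linearly dependent. Adjoining a root of a monic polynomial gives another such ring.
\<close>

definition fd_ring :: "complex set \<Rightarrow> bool"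
  where "fd_ring R \<longleftrightarrow> 1 \<in> R \<and> (\<forall>x\<in>R. \<forall>y\<in>R. x * y \<in> R) \<and> (\<exists>B. finite B \<and> R = rat_space.span B)"

lemma fd_ring_subspace: "fd_ring R \<Longrightarrow> rat_space.subspace R"
  by (auto simp: fd_ring_def)

lemma fd_ring_1: "fd_ring R \<Longrightarrow> 1 \<in> R"
  and fd_ring_mult: "fd_ring R \<Longrightarrow> x \<in> R \<Longrightarrow> y \<in> R \<Longrightarrow> x * y \<in> R"
  by (auto simp: fd_ring_def)

lemma fd_ring_add: "fd_ring R \<Longrightarrow> x \<in> R \<Longrightarrow> y \<in> R \<Longrightarrow> x + y \<in> R"
  using fd_ring_subspace rat_space.subspace_add by blast

lemma fd_ring_power: "fd_ring R \<Longrightarrow> x \<in> R \<Longrightarrow> x ^ n \<in> R"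
  by (induction n) (auto intro: fd_ring_1 fd_ring_mult)

lemma fd_ring_Rats: "fd_ring \<rat>"
proof -
  have "rat_space.span {1} = \<rat>"
    by (auto simp: rat_space.span_singleton Rats_def)
  then show ?thesis
    unfolding fd_ring_def by (intro conjI exI[of _ "{1}"]) auto
qed

lemma fd_ring_imp_algebraic:
  assumes "fd_ring R" "x \<in> R"
  shows "algebraic x"
proof -
  obtain B where B: "finite B" "R = rat_space.span B"
    using assms by (auto simp: fd_ring_def)
  define N where "N = card B"
  show ?thesis
  \<comment> \<open>Linear dependence is a property of sets, so coinciding powers would shrink
    \<open>T\<close>. A coincidence is treated separately: it gives a difference of two monomials
    with root \<open>x\<close>.\<close>
  proof (cases "inj_on (\<lambda>i. x ^ i) {..N}")
    case False
    then obtain i j where ij: "i \<noteq> j" "x ^ i = x ^ j"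
      by (auto simp: inj_on_def)
    define p :: "complex poly" where "p = monom 1 i - monom 1 j"
    have "coeff p i = 1"
      using ij by (simp add: p_def)
    then have "p \<noteq> 0" by auto
    moreover have "coeff p k \<in> \<rat>" for k
      by (simp add: p_def)
    moreover have "poly p x = 0"
      using ij by (simp add: p_def poly_monom)
    ultimately show ?thesis by (intro algebraicI'[of p])
  next
    case True
    define T where "T = (\<lambda>i. x ^ i) ` {..N}"
    have "card T = Suc N"
      unfolding T_def using card_image[OF True] by simp
    moreover have "T \<subseteq> rat_space.span B"
      unfolding T_def using fd_ring_power[OF assms] B by blast
    ultimately have "rat_space.dependent T"
      using rat_space.independent_span_bound[OF B(1)] unfolding N_def by force
    moreover have "finite T"
      by (simp add: T_def)
    ultimately obtain u where u: "\<exists>v\<in>T. u v \<noteq> 0" "(\<Sum>v\<in>T. of_rat (u v) * v) = 0"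
      using rat_space.dependent_finite by auto
    define p :: "complex poly" where "p = (\<Sum>i\<le>N. monom (of_rat (u (x ^ i))) i)"
    have cp: "coeff p k = (if k \<le> N then of_rat (u (x ^ k)) else 0)" for k
      by (simp add: p_def coeff_sum coeff_monom)
    have "poly p x = (\<Sum>i\<le>N. of_rat (u (x ^ i)) * x ^ i)"
      by (simp add: p_def poly_sum poly_monom)
    also have "\<dots> = (\<Sum>v\<in>T. of_rat (u v) * v)"
      unfolding T_def by (subst sum.reindex[OF True]) simp
    finally have "poly p x = 0"
      using u by simp
    moreover obtain k where "k \<le> N" "u (x ^ k) \<noteq> 0"
      using u by (auto simp: T_def)
    then have "coeff p k \<noteq> 0"
      by (simp add: cp)
    then have "p \<noteq> 0" by auto
    moreover have "coeff p i \<in> \<rat>" for i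
      by (simp add: cp)
    ultimately show ?thesis by (intro algebraicI'[of p])
  qed
qed

text \<open>The ring generated by \<open>R\<close> and \<open>x\<close> appears in two guises. As
  the set \<open>R'\<close> of values at \<open>x\<close> of polynomials over \<open>R\<close> it is
  visibly closed under products; as the span \<open>M\<close> of the products
  \<open>b * x ^ j\<close> with \<open>j < n\<close> it is visibly finite-dimensional. Monicity
  rewrites \<open>x ^ n\<close> by lower powers, which makes \<open>M\<close> closed under
  multiplication by \<open>x\<close> and gives \<open>R' = M\<close>.\<close>

lemma fd_ring_adjoin:
  assumes R: "fd_ring R" and p: "\<And>i. coeff p i \<in> R" "lead_coeff p = 1" and x: "poly p x = 0"
  obtains R' where "fd_ring R'" "R \<subseteq> R'" "x \<in> R'"
proof -
  obtain B where B: "finite B" "R = rat_space.span B"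
    using R by (auto simp: fd_ring_def)
  define n where "n = degree p"
  \<comment> \<open>A monic constant has no root. With \<open>n\<close> positive the exponent
    \<open>0\<close> occurs in \<open>C\<close>, so \<open>M\<close> contains
    \<open>R\<close>.\<close>
  have "n \<noteq> 0"
    using p x unfolding n_def by (metis degree_0_id one_neq_zero poly_const_conv)
  define C where "C = (\<lambda>(b, j). b * x ^ j) ` (B \<times> {..<n})"
  define M where "M = rat_space.span C"
  have M: "rat_space.subspace M"
    by (simp add: M_def)
  have RxM: "r * x ^ j \<in> M" if "r \<in> R" "j < n" for r j
    using that(1) unfolding B(2)
  proof (induction rule: rat_space.span_induct_alt)
    case base
    then show ?case using rat_space.subspace_0[OF M] by simp
  next
    case (step c b y)
    have "b * x ^ j \<in> M"
      unfolding M_def using step that by (intro rat_space.span_base) (auto simp: C_def)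
    then have "of_rat c * (b * x ^ j) + y * x ^ j \<in> M"
      using step rat_space.subspace_add[OF M] rat_space.subspace_scale[OF M] by blast
    then show ?case by (simp add: algebra_simps)
  qed
  have RM: "r * m \<in> M" if "r \<in> R" "m \<in> M" for r m
    using that(2) unfolding M_def
  proof (induction rule: rat_space.span_induct_alt)
    case base
    then show ?case using rat_space.subspace_0[OF M] by (simp add: M_def)
  next
    case (step c y z)
    obtain b j where y: "y = b * x ^ j" "b \<in> B" "j < n"
      using step by (auto simp: C_def)
    have "(r * b) * x ^ j \<in> M"
      using y that R B by (intro RxM) (auto intro: fd_ring_mult rat_space.span_base)
    then have "of_rat c * ((r * b) * x ^ j) + r * z \<in> M"
      using step rat_space.subspace_add[OF M] rat_space.subspace_scale[OF M]
      unfolding M_def by blast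
    then show ?case by (simp add: y algebra_simps M_def)
  qed
  have "x ^ n = - (\<Sum>i<n. coeff p i * x ^ i)"
    using x p(2) by (simp add: poly_altdef n_def lessThan_Suc_atMost[symmetric] eq_neg_iff_add_eq_0 add.commute)
  then have xn: "x ^ n \<in> M"
    using RxM[OF p(1)] by (auto intro!: rat_space.subspace_neg[OF M] rat_space.subspace_sum[OF M])
  have xM: "x * m \<in> M" if "m \<in> M" for m
    using that unfolding M_def
  proof (induction rule: rat_space.span_induct_alt)
    case base
    then show ?case using rat_space.subspace_0[OF M] by (simp add: M_def)
  next
    case (step c y z)
    obtain b j where y: "y = b * x ^ j" "b \<in> B" "j < n"
      using step by (auto simp: C_def)
    have b: "b \<in> R"
      using y B by (auto intro: rat_space.span_base)
    have "b * x ^ Suc j \<in> M"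
    proof (cases "Suc j = n")
      case True
      show ?thesis using RM[OF b xn] True by simp
    next
      case False
      then show ?thesis using RxM[OF b, of "Suc j"] y by simp
    qed
    then have "of_rat c * (b * x ^ Suc j) + x * z \<in> M"
      using step rat_space.subspace_add[OF M] rat_space.subspace_scale[OF M]
      unfolding M_def by blast
    then show ?case by (simp add: y algebra_simps M_def)
  qed
  define R' where "R' = {poly q x | q. \<forall>i. coeff q i \<in> R}"
  have R0: "0 \<in> R"
    using rat_space.subspace_0[OF fd_ring_subspace[OF R]] .
  have const: "r \<in> R'" if "r \<in> R" for r
    unfolding R'_def using that R0
    by (intro CollectI exI[of _ "[:r:]"]) (auto simp: coeff_pCons split: nat.splits)
  have R'M: "R' \<subseteq> M"
  proof -
    have "poly q x \<in> M" if "\<forall>i. coeff q i \<in> R" for q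
      using that
    proof (induction q)
      case 0
      then show ?case using rat_space.subspace_0[OF M] by simp
    next
      case (pCons a q)
      have "coeff q i \<in> R" for i
        using pCons.prems[rule_format, of "Suc i"] by simp
      moreover have "a \<in> R"
        using pCons.prems[rule_format, of 0] by simp
      then have "a \<in> M"
        using RxM[of a 0] \<open>n \<noteq> 0\<close> by simp
      ultimately show ?case
        using pCons.IH xM by (simp add: rat_space.subspace_add[OF M])
    qed
    then show ?thesis by (auto simp: R'_def)
  qed
  have coeffmult: "coeff (q * q') i \<in> R" if "\<forall>i. coeff q i \<in> R" "\<forall>i. coeff q' i \<in> R" for q q' i
    unfolding coeff_mult using that
    by (intro rat_space.subspace_sum[OF fd_ring_subspace[OF R]] fd_ring_mult[OF R]) auto
  have MR': "M \<subseteq> R'"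
  proof
    fix m assume "m \<in> M"
    then show "m \<in> R'"
      unfolding M_def
    proof (induction rule: rat_space.span_induct_alt)
      case base
      then show ?case using const[OF R0] .
    next
      case (step c y z)
      obtain b j where y: "y = b * x ^ j" "b \<in> B" "j < n"
        using step by (auto simp: C_def)
      obtain q where q: "z = poly q x" "\<forall>i. coeff q i \<in> R"
        using step by (auto simp: R'_def)
      have "of_rat c * b \<in> R"
        using y B rat_space.span_base rat_space.span_scale by blast
      then have "\<forall>i. coeff (monom (of_rat c * b) j + q) i \<in> R"
        using q R0 fd_ring_add[OF R] by (auto simp: coeff_monom)
      moreover have "of_rat c * y + z = poly (monom (of_rat c * b) j + q) x"
        by (simp add: y q poly_monom algebra_simps)
      ultimately show ?case unfolding R'_def by blast
    qed
  qed
  have "fd_ring R'"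
    unfolding fd_ring_def
  proof (intro conjI ballI)
    show "1 \<in> R'" using const fd_ring_1[OF R] by blast
    show "u * v \<in> R'" if "u \<in> R'" "v \<in> R'" for u v
      using that coeffmult unfolding R'_def by (force simp flip: poly_mult)
    show "\<exists>B. finite B \<and> R' = rat_space.span B"
      using R'M MR' B(1) by (intro exI[of _ C]) (auto simp: M_def C_def)
  qed
  moreover have "x \<in> R'"
    unfolding R'_def using R0 fd_ring_1[OF R]
    by (intro CollectI exI[of _ "[:0, 1:]"]) (auto simp: coeff_pCons split: nat.splits)
  ultimately show ?thesis
    using that const by blast
qed

lemma fd_ring_adjoin_algebraic:
  assumes "fd_ring R" "algebraic x"
  obtains R' where "fd_ring R'" "R \<subseteq> R'" "x \<in> R'"
proof -
  obtain p where p: "\<And>i. coeff p i \<in> \<rat>" "p \<noteq> 0" "poly p x = 0"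
    using assms(2) algebraic_altdef by auto
  define q where "q = smult (inverse (lead_coeff p)) p"
  have "\<rat> \<subseteq> R"
  proof
    fix r :: complex assume "r \<in> \<rat>"
    then obtain c where "r = of_rat c" by (auto simp: Rats_def)
    then show "r \<in> R"
      using rat_space.subspace_scale[OF fd_ring_subspace fd_ring_1] assms(1) by force
  qed
  then have "coeff q i \<in> R" for i
    using p(1) by (auto simp: q_def)
  moreover have "lead_coeff q = 1" "poly q x = 0"
    using p by (auto simp: q_def)
  ultimately show ?thesis
    using fd_ring_adjoin[OF assms(1)] that by blast
qed

text \<open>Sums and products of algebraic numbers are controlled by placing both numbers in one
  finite-dimensional ring, obtained by two successive adjunctions to \<open>\<rat>\<close>.\<close>

lemma algebraic_pair:
  assumes "algebraic x" "algebraic y"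
  obtains R where "fd_ring R" "x \<in> R" "y \<in> R"
  using fd_ring_adjoin_algebraic[OF fd_ring_Rats assms(1)] fd_ring_adjoin_algebraic[OF _ assms(2)]
  by (metis subsetD)

lemma algebraic_add: "algebraic (x + y)" if "algebraic x" "algebraic y" for x y :: complex
  using that by (metis algebraic_pair fd_ring_add fd_ring_imp_algebraic)

lemma algebraic_mult: "algebraic (x * y)" if "algebraic x" "algebraic y" for x y :: complex
  using that by (metis algebraic_pair fd_ring_mult fd_ring_imp_algebraic)

lemma fd_ring_adjoin_finite:
  assumes "finite X" "\<And>x. x \<in> X \<Longrightarrow> algebraic x"
  shows "\<exists>R. fd_ring R \<and> X \<subseteq> R"
  using assms
proof (induction rule: finite_induct)
  case empty
  then show ?case using fd_ring_Rats by blast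
next
  case (insert x X)
  then obtain R where R: "fd_ring R" "X \<subseteq> R"
    by auto
  obtain R' where "fd_ring R'" "R \<subseteq> R'" "x \<in> R'"
    using fd_ring_adjoin_algebraic[OF R(1)] insert.prems by blast
  then show ?case
    using R by blast
qed

text \<open>After division by the leading coefficient, the finitely many coefficients lie in one
  finite-dimensional ring, and adjoining the root gives another. This is what makes fibers over
  algebraic points algebraic.\<close>

lemma algebraic_poly_root:
  fixes p :: "complex poly"
  assumes p: "\<And>i. algebraic (coeff p i)" "p \<noteq> 0" and x: "poly p x = 0"
  shows "algebraic x"
proof -
  define q where "q = smult (inverse (lead_coeff p)) p"
  have q: "algebraic (coeff q i)" "lead_coeff q = 1" "poly q x = 0" for i
    using p x by (auto simp: q_def algebraic_mult algebraic_inverse)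
  have "range (coeff q) \<subseteq> coeff q ` {..degree q} \<union> {0}"
    by (auto simp: image_iff) (metis coeff_eq_0 atMost_iff linorder_not_le)
  then have "finite (range (coeff q))"
    by (rule finite_subset) auto
  then obtain R where "fd_ring R" "range (coeff q) \<subseteq> R"
    using fd_ring_adjoin_finite[of "range (coeff q)"] q by blast
  then show ?thesis
    using fd_ring_adjoin[of R q x] q fd_ring_imp_algebraic by (metis rangeI subsetD)
qed

section \<open>Closure properties of the set of algebraic numbers\<close>

lemma Qbar_Rats: "x \<in> \<rat> \<Longrightarrow> x \<in> Qbar"
  and Qbar_add: "x \<in> Qbar \<Longrightarrow> y \<in> Qbar \<Longrightarrow> x + y \<in> Qbar"
  and Qbar_minus: "x \<in> Qbar \<Longrightarrow> - x \<in> Qbar"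
  and Qbar_mult: "x \<in> Qbar \<Longrightarrow> y \<in> Qbar \<Longrightarrow> x * y \<in> Qbar"
  and Qbar_inverse: "x \<in> Qbar \<Longrightarrow> inverse x \<in> Qbar"
  by (auto simp: Qbar_def rat_imp_algebraic algebraic_add algebraic_mult)

lemma Qbar_diff: "x \<in> Qbar \<Longrightarrow> y \<in> Qbar \<Longrightarrow> x - y \<in> Qbar"
  using Qbar_add[of x "- y"] Qbar_minus[of y] by simp

lemma Qbar_divide: "x \<in> Qbar \<Longrightarrow> y \<in> Qbar \<Longrightarrow> x / y \<in> Qbar"
  using Qbar_mult[of x "inverse y"] Qbar_inverse[of y] by (simp add: divide_inverse)

lemma Qbar_sum: "(\<And>i. i \<in> I \<Longrightarrow> u i \<in> Qbar) \<Longrightarrow> sum u I \<in> Qbar"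
  by (induction I rule: infinite_finite_induct) (auto intro: Qbar_Rats Qbar_add)

lemma Qbar_power: "x \<in> Qbar \<Longrightarrow> x ^ n \<in> Qbar"
  by (induction n) (auto intro: Qbar_Rats Qbar_mult)

lemma Qbar_poly: "(\<And>i. coeff p i \<in> Qbar) \<Longrightarrow> x \<in> Qbar \<Longrightarrow> poly p x \<in> Qbar"
  by (auto simp: poly_altdef intro!: Qbar_sum Qbar_mult Qbar_power)

lemma Qbar_coeff_mult:
  "(\<And>i. coeff p i \<in> Qbar) \<Longrightarrow> (\<And>i. coeff q i \<in> Qbar) \<Longrightarrow> coeff (p * q) i \<in> Qbar"
  by (auto simp: coeff_mult intro!: Qbar_sum Qbar_mult)

lemma Qbar_coeff_prod_linear:
  assumes "\<And>i. i \<in> I \<Longrightarrow> v i \<in> Qbar"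
  shows "coeff (\<Prod>i\<in>I. [:- v i, 1:]) k \<in> Qbar"
  using assms
proof (induction I arbitrary: k rule: infinite_finite_induct)
  case (insert i I)
  have "coeff [:- v i, 1:] k \<in> Qbar" for k
    using insert.prems by (auto simp: coeff_pCons Qbar_minus Qbar_Rats split: nat.splits)
  then show ?case
    using insert by (simp add: Qbar_coeff_mult del: mult_pCons_left)
qed (auto simp: Qbar_Rats coeff_1)

text \<open>Induction on the degree, splitting off \<open>[:-a, 1:]\<close> at a point
  \<open>a\<close> of \<open>A\<close>: on the still infinite set \<open>A - {a}\<close> the
  quotient takes as values the difference quotients of \<open>p\<close>.\<close>

lemma Qbar_coeffs_by_values:
  fixes p :: "complex poly"
  assumes "infinite A" "A \<subseteq> Qbar" "\<And>a. a \<in> A \<Longrightarrow> poly p a \<in> Qbar"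
  shows "coeff p i \<in> Qbar"
  using assms
proof (induction "degree p" arbitrary: p A i)
  case 0
  then obtain c where "p = [:c:]"
    by (metis degree_0_id)
  moreover obtain a where "a \<in> A"
    using 0 by (metis finite.emptyI equals0I)
  ultimately show ?case
    using 0 by (auto simp: coeff_pCons Qbar_Rats split: nat.splits)
next
  case (Suc n)
  obtain a where a: "a \<in> A"
    using Suc by (metis finite.emptyI equals0I)
  have "[:-a, 1:] dvd p - [:poly p a:]"
    by (simp add: poly_eq_0_iff_dvd[symmetric])
  then obtain q where "p - [:poly p a:] = [:-a, 1:] * q" ..
  then have p: "p = [:poly p a:] + [:-a, 1:] * q"
    by (metis add.commute diff_add_cancel)
  have q0: "q \<noteq> 0"
    using p Suc.hyps(2) by (metis Suc_neq_Zero add.right_neutral degree_pCons_0 mult_zero_right)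
  have deg: "degree p = Suc (degree q)"
    by (subst p, subst degree_add_eq_right) (use q0 in \<open>auto simp: degree_mult_eq simp del: mult_pCons_left\<close>)
  have "coeff q j \<in> Qbar" for j
  proof (rule Suc.hyps(1)[of q "A - {a}"])
    show "poly q b \<in> Qbar" if "b \<in> A - {a}" for b
    proof -
      have "poly p b = poly p a + (b - a) * poly q b"
        by (subst p) (simp add: algebra_simps)
      then have "poly q b = (poly p b - poly p a) / (b - a)"
        using that by simp
      then show ?thesis
        using that a Suc.prems by (auto intro!: Qbar_divide Qbar_diff)
    qed
  qed (use Suc deg in auto)
  moreover have "coeff [:poly p a:] j \<in> Qbar" "coeff [:-a, 1:] j \<in> Qbar" for j
    using Suc.prems a by (auto simp: coeff_pCons Qbar_minus Qbar_Rats split: nat.splits)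
  ultimately show ?case
    by (subst p) (auto intro!: Qbar_add Qbar_coeff_mult simp del: mult_pCons_left)
qed

section \<open>Local inverse branches\<close>

definition fib :: "complex poly \<Rightarrow> complex \<Rightarrow> complex set"
  where "fib h t = {z. poly h z = t}"

text \<open>The bound on the degree makes \<open>h\<close> grow at least linearly at infinity.\<close>

definition belyi :: "complex poly \<Rightarrow> bool"
  where "belyi h \<longleftrightarrow> degree h \<ge> 2 \<and> poly h ` critical_points h \<subseteq> {0, 1}"

text \<open>A disc evenly covered by \<open>h\<close>, given with all its inverse branches at once:
  \<open>w z\<close> is the branch through the point \<open>z\<close> of the fiber over the centre
  \<open>t\<close>, so that this fiber indexes the branches.\<close>

definition local_sections :: "complex poly \<Rightarrow> complex \<Rightarrow> real \<Rightarrow> (complex \<Rightarrow> complex \<Rightarrow> complex) \<Rightarrow> bool"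
  where "local_sections h t r w \<longleftrightarrow> r > 0 \<and> ball t r \<subseteq> - {0, 1} \<and>
    (\<forall>z\<in>fib h t. w z holomorphic_on ball t r \<and> w z t = z) \<and>
    (\<forall>t'\<in>ball t r. bij_betw (\<lambda>z. w z t') (fib h t) (fib h t'))"

lemma poly_holomorphic: "poly p holomorphic_on A"
  using poly_holomorphic_on[OF holomorphic_on_ident] .

text \<open>A value outside \<open>{0, 1}\<close> is not critical, so \<open>h - [:t:]\<close> has
  only simple roots.\<close>

lemma fib_card:
  assumes "belyi h" "t \<notin> {0, 1}"
  shows "card (fib h t) = degree h"
proof -
  define p where "p = h - [:t:]"
  have d: "degree p = degree h"
    using degree_add_eq_left[of "[:- t:]" h] assms(1) by (simp add: p_def belyi_def diff_conv_add_uminus del: add_uminus_conv_diff)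
  then have "p \<noteq> 0"
    using assms(1) by (auto simp: belyi_def)
  have roots: "fib h t = {z. poly p z = 0}"
    by (auto simp: fib_def p_def)
  have "rsquarefree p"
    unfolding rsquarefree_roots
    using assms by (auto simp: p_def pderiv_diff pderiv_pCons belyi_def critical_points_def)
  then have "count (proots p) z = 1" if "z \<in> fib h t" for z
    using that rsquarefree_root_order \<open>p \<noteq> 0\<close> by (simp add: roots)
  then have "size (proots p) = card (fib h t)"
    using \<open>p \<noteq> 0\<close> by (simp add: size_multiset_overloaded_eq roots del: count_proots)
  then show ?thesis
    using d by (simp add: size_proots_complex)
qed

lemma fib_finite: "belyi h \<Longrightarrow> t \<notin> {0, 1} \<Longrightarrow> finite (fib h t)"
  using fib_card[of h t] by (intro card_ge_0_finite) (auto simp: belyi_def)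

lemma fib_nonempty: "belyi h \<Longrightarrow> t \<notin> {0, 1} \<Longrightarrow> fib h t \<noteq> {}"
  using fib_card[of h t] by (auto simp: belyi_def)

text \<open>Each point of the fiber is non-critical and has a ball on which \<open>h\<close> is
  injective. These balls are shrunk until they are disjoint, and the disc is taken inside the
  intersection of their images.\<close>

lemma local_sections_exist:
  assumes h: "belyi h" and t: "t \<notin> {0, 1}"
  obtains r w where "local_sections h t r w"
proof -
  define F where "F = fib h t"
  have F: "finite F" "F \<noteq> {}"
    using fib_finite[OF h t] fib_nonempty[OF h t] by (auto simp: F_def)
  have "\<exists>e>0. inj_on (poly h) (ball z e)" if "z \<in> F" for z
  proof -
    have "deriv (poly h) z \<noteq> 0"
      using that h t by (auto simp: poly_DERIV[THEN DERIV_imp_deriv] F_def fib_def belyi_def critical_points_def)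
    then show ?thesis
      by (rule has_complex_derivative_locally_injective[OF poly_holomorphic UNIV_I open_UNIV]) blast
  qed
  then obtain e where e: "\<And>z. z \<in> F \<Longrightarrow> e z > 0 \<and> inj_on (poly h) (ball z (e z))"
    by metis
  obtain d where d: "d > 0" "\<And>x y. x \<in> F \<Longrightarrow> y \<in> F \<Longrightarrow> x \<noteq> y \<Longrightarrow> d \<le> dist x y"
    using finite_set_avoid F
  proof -
    have "\<exists>d>0. \<forall>y\<in>F. y \<noteq> x \<longrightarrow> d \<le> dist x y" for x
      using finite_set_avoid[OF F(1)] by metis
    then obtain D where D: "\<And>x. D x > 0 \<and> (\<forall>y\<in>F. y \<noteq> x \<longrightarrow> D x \<le> dist x y)"
      by metis
    show ?thesis
    proof (rule that[of "Min (D ` F)"])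
      show "Min (D ` F) > 0" using F D by simp
      show "Min (D ` F) \<le> dist x y" if "x \<in> F" "y \<in> F" "x \<noteq> y" for x y
        using that F D by (metis Min_le dual_order.trans finite_imageI imageI)
    qed
  qed
  \<comment> \<open>Half of the minimal distance \<open>d\<close> keeps the balls around distinct
    points of the fiber disjoint.\<close>
  define \<rho> where "\<rho> z = min (e z) (d / 2)" for z
  have \<rho>: "\<rho> z > 0" "inj_on (poly h) (ball z (\<rho> z))" if "z \<in> F" for z
    using e[OF that] d(1) by (auto simp: \<rho>_def intro: inj_on_subset)
  have disj: "x = y" if "x \<in> F" "y \<in> F" "u \<in> ball x (\<rho> x)" "u \<in> ball y (\<rho> y)" for x y u
  proof (rule ccontr)
    assume "x \<noteq> y"
    then have "d \<le> dist x y" using d that by blast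
    then show False
      using that dist_triangle[of x y u] by (auto simp: \<rho>_def dist_commute)
  qed
  have op: "open (poly h ` ball z (\<rho> z))" if "z \<in> F" for z
    using open_mapping_thm3[OF poly_holomorphic open_ball \<rho>(2)[OF that]] .
  have "\<exists>g. g holomorphic_on poly h ` ball z (\<rho> z) \<and> (\<forall>u\<in>ball z (\<rho> z). g (poly h u) = u)" if "z \<in> F" for z
  proof -
    obtain g where "g holomorphic_on poly h ` ball z (\<rho> z)" "\<And>u. u \<in> ball z (\<rho> z) \<Longrightarrow> g (poly h u) = u"
      by (rule holomorphic_has_inverse[OF poly_holomorphic open_ball \<rho>(2)[OF \<open>z \<in> F\<close>]]) blast
    then show ?thesis by blast
  qed
  then have "\<exists>w. \<forall>z\<in>F. w z holomorphic_on poly h ` ball z (\<rho> z) \<and> (\<forall>u\<in>ball z (\<rho> z). w z (poly h u) = u)"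
    by (intro bchoice) blast
  then obtain w where w: "\<And>z. z \<in> F \<Longrightarrow> w z holomorphic_on poly h ` ball z (\<rho> z)"
      "\<And>z u. z \<in> F \<Longrightarrow> u \<in> ball z (\<rho> z) \<Longrightarrow> w z (poly h u) = u"
    by blast
  have "open ((\<Inter>z\<in>F. poly h ` ball z (\<rho> z)) \<inter> - {0, 1})"
    using F op by (intro open_Int open_INT) auto
  moreover have "t \<in> (\<Inter>z\<in>F. poly h ` ball z (\<rho> z)) \<inter> - {0, 1}"
    using t \<rho> by (auto simp: F_def fib_def image_iff intro!: bexI)
  ultimately obtain r where r: "r > 0" "ball t r \<subseteq> (\<Inter>z\<in>F. poly h ` ball z (\<rho> z)) \<inter> - {0, 1}"
    by (meson open_contains_ball)
  have wb: "w z t' \<in> ball z (\<rho> z)" "poly h (w z t') = t'" if zt: "z \<in> F" "t' \<in> ball t r" for z t'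
  proof -
    obtain u where "u \<in> ball z (\<rho> z)" "t' = poly h u"
      using zt r by blast
    then show "w z t' \<in> ball z (\<rho> z)" "poly h (w z t') = t'"
      using w that by auto
  qed
  have "local_sections h t r w"
    unfolding local_sections_def
  proof (intro conjI ballI)
    fix z assume z: "z \<in> fib h t"
    show "w z holomorphic_on ball t r"
      using w(1)[of z] r z by (auto simp: F_def intro: holomorphic_on_subset)
    show "w z t = z"
      using w(2)[of z z] z \<rho>(1)[of z] by (auto simp: F_def fib_def)
  next
    fix t' assume t': "t' \<in> ball t r"
    have "inj_on (\<lambda>z. w z t') F"
      using wb(1)[OF _ t'] disj unfolding inj_on_def by metis
    moreover have "(\<lambda>z. w z t') ` F = fib h t'"
    \<comment> \<open>Surjectivity is a count: the branches give \<open>degree h\<close> distinct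
      points of \<open>fib h t'\<close>, which has exactly that many elements.\<close>
    proof (rule card_seteq)
      show "finite (fib h t')" using fib_finite h t' r by blast
      show "(\<lambda>z. w z t') ` F \<subseteq> fib h t'" using wb(2)[OF _ t'] by (auto simp: fib_def)
      show "card (fib h t') \<le> card ((\<lambda>z. w z t') ` F)"
      proof -
        have "t' \<notin> {0, 1}" using t' r by blast
        then show ?thesis
          using fib_card[OF h] t card_image[OF \<open>inj_on (\<lambda>z. w z t') F\<close>] by (simp add: F_def)
      qed
    qed
    ultimately show "bij_betw (\<lambda>z. w z t') (fib h t) (fib h t')"
      by (simp add: bij_betw_def F_def)
  qed (use r in auto)
  then show ?thesis by (rule that)
qed

lemma
  assumes "local_sections h t r w"
  shows local_sections_pos: "r > 0"
    and local_sections_ball: "ball t r \<subseteq> - {0, 1}"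
    and local_sections_holomorphic: "z \<in> fib h t \<Longrightarrow> w z holomorphic_on ball t r"
    and local_sections_centre: "z \<in> fib h t \<Longrightarrow> w z t = z"
    and local_sections_bij: "t' \<in> ball t r \<Longrightarrow> bij_betw (\<lambda>z. w z t') (fib h t) (fib h t')"
  using assms by (auto simp: local_sections_def)

lemma local_sections_poly:
  assumes "local_sections h t r w" "z \<in> fib h t" "t' \<in> ball t r"
  shows "poly h (w z t') = t'"
  using bij_betw_apply[OF local_sections_bij[OF assms(1,3)] assms(2)] by (simp add: fib_def)

text \<open>The sheets over a disc are its images under the inverse branches. The covering property
  serves to lift the open segment when edges are compared with fibers.\<close>

lemma belyi_covering_space:
  assumes h: "belyi h"
  shows "covering_space (- (poly h -` {0, 1})) (poly h) (- {0, 1})"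
  unfolding covering_space_def
proof (intro conjI ballI)
  show "continuous_on (- (poly h -` {0, 1})) (poly h)"
    by (intro continuous_intros)
  show "poly h ` (- (poly h -` {0, 1})) = - {0, 1}"
    using fib_nonempty[OF h] by (force simp: fib_def)
  fix t :: complex assume "t \<in> - {0, 1}"
  then obtain r w where rw: "local_sections h t r w"
    using local_sections_exist[OF h] by blast
  note b = local_sections_ball[OF rw]
  define V where "V = (\<lambda>z. w z ` ball t r) ` fib h t"
  have inj: "inj_on (w z) (ball t r)" if "z \<in> fib h t" for z
    using local_sections_poly[OF rw that] by (metis inj_onI)
  show "\<exists>T. t \<in> T \<and> openin (top_of_set (- {0, 1})) T \<and>
      (\<exists>v. \<Union> v = - (poly h -` {0, 1}) \<inter> poly h -` T \<and>
        (\<forall>u\<in>v. openin (top_of_set (- (poly h -` {0, 1}))) u) \<and>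
        pairwise disjnt v \<and> (\<forall>u\<in>v. \<exists>q. homeomorphism u T (poly h) q))"
  proof (intro exI[of _ "ball t r"] conjI exI[of _ V] ballI)
    show "t \<in> ball t r" using local_sections_pos[OF rw] by simp
    show "openin (top_of_set (- {0, 1})) (ball t r)"
      using b by (intro open_subset) auto
    show "\<Union>V = - (poly h -` {0, 1}) \<inter> poly h -` ball t r"
    proof (intro equalityI subsetI)
      fix u assume "u \<in> \<Union>V"
      then show "u \<in> - (poly h -` {0, 1}) \<inter> poly h -` ball t r"
        using local_sections_poly[OF rw] b by (force simp: V_def)
    next
      fix u assume u: "u \<in> - (poly h -` {0, 1}) \<inter> poly h -` ball t r"
      then have "u \<in> (\<lambda>z. w z (poly h u)) ` fib h t"
        using bij_betw_imp_surj_on[OF local_sections_bij[OF rw, of "poly h u"]] by (auto simp: fib_def)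
      then show "u \<in> \<Union>V" using u unfolding V_def by blast
    qed
    show "pairwise disjnt V"
    proof (clarsimp simp: V_def pairwise_def disjnt_def)
      fix x y assume xy: "x \<in> fib h t" "y \<in> fib h t" "w x ` ball t r \<noteq> w y ` ball t r"
      show "w x ` ball t r \<inter> w y ` ball t r = {}"
      proof (rule ccontr)
        assume "w x ` ball t r \<inter> w y ` ball t r \<noteq> {}"
        then obtain a a' where a: "a \<in> ball t r" "a' \<in> ball t r" "w x a = w y a'"
          by blast
        then have "a = a'"
          using local_sections_poly[OF rw] xy by metis
        then have "x = y"
          using a xy bij_betw_imp_inj_on[OF local_sections_bij[OF rw a(1)]] by (auto simp: inj_on_def)
        then show False using xy by blast
      qed
    qed
  next
    fix u assume "u \<in> V"
    then obtain z where z: "z \<in> fib h t" "u = w z ` ball t r"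
      by (auto simp: V_def)
    have "open u"
      unfolding z(2) using inj[OF z(1)] local_sections_holomorphic[OF rw z(1)]
      by (intro open_mapping_thm3) auto
    moreover have "u \<subseteq> - (poly h -` {0, 1})"
      using local_sections_poly[OF rw z(1)] b z(2) by auto
    moreover have "open (- (poly h -` {0, 1}))"
      by (intro open_Compl closed_vimage) (auto intro: continuous_intros)
    ultimately show "openin (top_of_set (- (poly h -` {0, 1}))) u"
      by (simp add: openin_open_eq)
    show "\<exists>q. homeomorphism u (ball t r) (poly h) q"
    proof (rule exI[of _ "w z"], rule homeomorphismI)
      show "continuous_on (ball t r) (w z)"
        using local_sections_holomorphic[OF rw z(1)] holomorphic_on_imp_continuous_on by blast
    qed (use local_sections_poly[OF rw z(1)] z in \<open>auto intro: continuous_intros\<close>)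
  qed
qed

text \<open>Every competing branch \<open>w z'\<close> tends to \<open>z' \<noteq> z\<close> at
  \<open>s\<close>, so near \<open>s\<close> the lift avoids these finitely many branches and has to
  follow \<open>w z\<close>. The parameter space is kept general: it is an interval for paths, and a
  disc when two systems of branches are compared.\<close>

lemma local_sections_lift:
  fixes \<delta> :: "'a::t2_space \<Rightarrow> complex"
  assumes h: "belyi h" and rw: "local_sections h t r w" and z: "z \<in> fib h t"
    and \<delta>: "continuous (at s within S) \<delta>" "\<delta> s = z" "s \<in> S"
    and \<gamma>: "continuous (at s within S) \<gamma>" "\<gamma> s = t" "\<And>u. u \<in> S \<Longrightarrow> poly h (\<delta> u) = \<gamma> u"
  shows "\<forall>\<^sub>F u in at s within S. \<delta> u = w z (\<gamma> u)"
proof -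
  have t: "t \<in> ball t r"
    using local_sections_pos[OF rw] by simp
  then have t01: "t \<notin> {0, 1}"
    using local_sections_ball[OF rw] by blast
  have \<gamma>t: "(\<gamma> \<longlongrightarrow> t) (at s within S)"
    using \<gamma> by (simp add: continuous_within)
  have ev1: "\<forall>\<^sub>F u in at s within S. \<gamma> u \<in> ball t r"
    using \<gamma>t t open_ball topological_tendstoD by blast
  have neq: "\<forall>\<^sub>F u in at s within S. \<delta> u \<noteq> w z' (\<gamma> u)" if z': "z' \<in> fib h t - {z}" for z'
  proof -
    have "continuous (at t) (w z')"
      using local_sections_holomorphic[OF rw, of z'] z' t
      by (auto dest!: holomorphic_on_imp_continuous_on simp: continuous_on_eq_continuous_at)
    then have "((\<lambda>u. w z' (\<gamma> u)) \<longlongrightarrow> z') (at s within S)"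
      using isCont_tendsto_compose[OF _ \<gamma>t, of "w z'"] z' local_sections_centre[OF rw, of z'] by simp
    moreover have "(\<delta> \<longlongrightarrow> z) (at s within S)"
      using \<delta> by (simp add: continuous_within)
    ultimately have "((\<lambda>u. \<delta> u - w z' (\<gamma> u)) \<longlongrightarrow> z - z') (at s within S)"
      by (intro tendsto_diff)
    then have "\<forall>\<^sub>F u in at s within S. \<delta> u - w z' (\<gamma> u) \<noteq> 0"
      using z' by (intro tendsto_imp_eventually_ne) auto
    then show ?thesis by simp
  qed
  have "finite (fib h t - {z})"
    using fib_finite[OF h t01] by simp
  then have "\<forall>\<^sub>F u in at s within S. \<forall>z'\<in>fib h t - {z}. \<delta> u \<noteq> w z' (\<gamma> u)"
    using neq by (simp add: eventually_ball_finite_distrib)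
  moreover have "\<forall>\<^sub>F u in at s within S. u \<in> S"
    by (simp add: eventually_at_topological) blast
  ultimately show ?thesis
    using ev1
  proof eventually_elim
    case (elim u)
    have "\<delta> u \<in> (\<lambda>z. w z (\<gamma> u)) ` fib h t"
      using bij_betw_imp_surj_on[OF local_sections_bij[OF rw elim(3)]] \<gamma>(3)[OF elim(2)]
      by (auto simp: fib_def)
    then show ?case using elim(1) by auto
  qed
qed

section \<open>Transport of fibers along paths\<close>

text \<open>A single path has to induce all values of \<open>\<phi>\<close> simultaneously. The
  lifts avoid the preimages of \<open>0\<close> and \<open>1\<close> because they lie over
  \<open>\<gamma>\<close>. Extensionality makes each map between fibers one function, so that such
  maps can be counted.\<close>

definition path_transports :: "complex poly \<Rightarrow> complex \<Rightarrow> complex \<Rightarrow> (complex \<Rightarrow> complex) set"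
  where "path_transports h s t =
    {\<phi> \<in> extensional (fib h s). bij_betw \<phi> (fib h s) (fib h t) \<and>
      (\<exists>\<gamma>. path \<gamma> \<and> path_image \<gamma> \<subseteq> - {0, 1} \<and> pathstart \<gamma> = s \<and> pathfinish \<gamma> = t \<and>
        (\<forall>z\<in>fib h s. \<exists>\<delta>. path \<delta> \<and> (\<forall>u\<in>{0..1}. poly h (\<delta> u) = \<gamma> u) \<and>
           pathstart \<delta> = z \<and> pathfinish \<delta> = \<phi> z))}"

lemma path_transports_compose:
  assumes "\<phi> \<in> path_transports h s t" "\<psi> \<in> path_transports h t u"
  shows "compose (fib h s) \<psi> \<phi> \<in> path_transports h s u"
proof -
  obtain \<gamma> where \<gamma>: "path \<gamma>" "path_image \<gamma> \<subseteq> - {0, 1}" "pathstart \<gamma> = s" "pathfinish \<gamma> = t"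
    "\<And>z. z \<in> fib h s \<Longrightarrow> \<exists>\<delta>. path \<delta> \<and> (\<forall>u\<in>{0..1}. poly h (\<delta> u) = \<gamma> u) \<and>
           pathstart \<delta> = z \<and> pathfinish \<delta> = \<phi> z"
    using assms(1) unfolding path_transports_def by blast
  obtain \<gamma>' where \<gamma>': "path \<gamma>'" "path_image \<gamma>' \<subseteq> - {0, 1}" "pathstart \<gamma>' = t" "pathfinish \<gamma>' = u"
    "\<And>z. z \<in> fib h t \<Longrightarrow> \<exists>\<delta>. path \<delta> \<and> (\<forall>u\<in>{0..1}. poly h (\<delta> u) = \<gamma>' u) \<and>
           pathstart \<delta> = z \<and> pathfinish \<delta> = \<psi> z"
    using assms(2) unfolding path_transports_def by blast
  have b: "bij_betw \<phi> (fib h s) (fib h t)" "bij_betw \<psi> (fib h t) (fib h u)"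
    using assms by (auto simp: path_transports_def)
  show ?thesis
    unfolding path_transports_def
  proof (intro CollectI conjI exI[of _ "\<gamma> +++ \<gamma>'"])
    show "bij_betw (compose (fib h s) \<psi> \<phi>) (fib h s) (fib h u)"
      using b by (rule bij_betw_compose)
    show "path_image (\<gamma> +++ \<gamma>') \<subseteq> - {0, 1}"
      using \<gamma> \<gamma>' path_image_join_subset by blast
    show "\<forall>z\<in>fib h s. \<exists>\<delta>. path \<delta> \<and> (\<forall>u\<in>{0..1}. poly h (\<delta> u) = (\<gamma> +++ \<gamma>') u) \<and>
           pathstart \<delta> = z \<and> pathfinish \<delta> = compose (fib h s) \<psi> \<phi> z"
    proof
      fix z assume z: "z \<in> fib h s"
      obtain \<delta> where \<delta>: "path \<delta>" "\<forall>u\<in>{0..1}. poly h (\<delta> u) = \<gamma> u" "pathstart \<delta> = z" "pathfinish \<delta> = \<phi> z"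
        using \<gamma>(5)[OF z] by blast
      have "\<phi> z \<in> fib h t"
        using b(1) z by (rule bij_betw_apply)
      then obtain \<delta>' where \<delta>': "path \<delta>'" "\<forall>u\<in>{0..1}. poly h (\<delta>' u) = \<gamma>' u" "pathstart \<delta>' = \<phi> z" "pathfinish \<delta>' = \<psi> (\<phi> z)"
        using \<gamma>'(5) by blast
      show "\<exists>\<delta>. path \<delta> \<and> (\<forall>u\<in>{0..1}. poly h (\<delta> u) = (\<gamma> +++ \<gamma>') u) \<and>
             pathstart \<delta> = z \<and> pathfinish \<delta> = compose (fib h s) \<psi> \<phi> z"
      proof (intro exI[of _ "\<delta> +++ \<delta>'"] conjI)
        show "path (\<delta> +++ \<delta>')"
          using \<delta> \<delta>' by simp
      qed (use \<delta> \<delta>' z in \<open>auto simp: joinpaths_def compose_eq pathfinish_def pathstart_def\<close>)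
    qed
  qed (use \<gamma> \<gamma>' in auto)
qed

lemma path_transports_inverse:
  assumes "\<phi> \<in> path_transports h s t"
  shows "restrict (inv_into (fib h s) \<phi>) (fib h t) \<in> path_transports h t s"
proof -
  obtain \<gamma> where \<gamma>: "path \<gamma>" "path_image \<gamma> \<subseteq> - {0, 1}" "pathstart \<gamma> = s" "pathfinish \<gamma> = t"
    "\<And>z. z \<in> fib h s \<Longrightarrow> \<exists>\<delta>. path \<delta> \<and> (\<forall>u\<in>{0..1}. poly h (\<delta> u) = \<gamma> u) \<and>
           pathstart \<delta> = z \<and> pathfinish \<delta> = \<phi> z"
    using assms(1) unfolding path_transports_def by blast
  have b: "bij_betw \<phi> (fib h s) (fib h t)"
    using assms by (auto simp: path_transports_def)
  show ?thesis
    unfolding path_transports_def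
  proof (intro CollectI conjI exI[of _ "reversepath \<gamma>"])
    show "bij_betw (restrict (inv_into (fib h s) \<phi>) (fib h t)) (fib h t) (fib h s)"
      using bij_betw_inv_into[OF b] by simp
    show "\<forall>z\<in>fib h t. \<exists>\<delta>. path \<delta> \<and> (\<forall>u\<in>{0..1}. poly h (\<delta> u) = reversepath \<gamma> u) \<and>
           pathstart \<delta> = z \<and> pathfinish \<delta> = restrict (inv_into (fib h s) \<phi>) (fib h t) z"
    proof
      fix z assume z: "z \<in> fib h t"
      define y where "y = inv_into (fib h s) \<phi> z"
      have y: "y \<in> fib h s" "\<phi> y = z"
        using z b unfolding y_def by (auto simp: bij_betw_def inv_into_into f_inv_into_f)
      obtain \<delta> where \<delta>: "path \<delta>" "\<forall>u\<in>{0..1}. poly h (\<delta> u) = \<gamma> u" "pathstart \<delta> = y" "pathfinish \<delta> = z"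
        using \<gamma>(5)[OF y(1)] y(2) by blast
      show "\<exists>\<delta>. path \<delta> \<and> (\<forall>u\<in>{0..1}. poly h (\<delta> u) = reversepath \<gamma> u) \<and>
             pathstart \<delta> = z \<and> pathfinish \<delta> = restrict (inv_into (fib h s) \<phi>) (fib h t) z"
      proof (intro exI[of _ "reversepath \<delta>"] conjI)
        show "path (reversepath \<delta>)"
          using \<delta> by simp
      qed (use \<delta> z in \<open>auto simp: reversepath_def y_def pathfinish_def pathstart_def\<close>)
    qed
  qed (use \<gamma> in auto)
qed

text \<open>The segment from the centre stays in the disc, and its lift from \<open>z\<close> is its
  image under \<open>w z\<close>.\<close>

lemma path_transports_local:
  assumes rw: "local_sections h t r w" and t': "t' \<in> ball t r"
  shows "restrict (\<lambda>z. w z t') (fib h t) \<in> path_transports h t t'"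
proof -
  have seg: "path_image (linepath t t') \<subseteq> ball t r"
    using t' local_sections_pos[OF rw] closed_segment_subset[of t "ball t r" t'] by auto
  show ?thesis
    unfolding path_transports_def
  proof (intro CollectI conjI exI[of _ "linepath t t'"])
    show "bij_betw (restrict (\<lambda>z. w z t') (fib h t)) (fib h t) (fib h t')"
      using local_sections_bij[OF rw t'] by simp
    show "path_image (linepath t t') \<subseteq> - {0, 1}"
      using seg local_sections_ball[OF rw] by blast
    show "\<forall>z\<in>fib h t. \<exists>\<delta>. path \<delta> \<and> (\<forall>u\<in>{0..1}. poly h (\<delta> u) = linepath t t' u) \<and>
           pathstart \<delta> = z \<and> pathfinish \<delta> = restrict (\<lambda>z. w z t') (fib h t) z"
    proof
      fix z assume z: "z \<in> fib h t"
      show "\<exists>\<delta>. path \<delta> \<and> (\<forall>u\<in>{0..1}. poly h (\<delta> u) = linepath t t' u) \<and>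
             pathstart \<delta> = z \<and> pathfinish \<delta> = restrict (\<lambda>z. w z t') (fib h t) z"
      proof (intro exI[of _ "w z \<circ> linepath t t'"] conjI ballI)
        show "path (w z \<circ> linepath t t')"
          using seg local_sections_holomorphic[OF rw z]
          by (intro path_continuous_image) (auto intro: holomorphic_on_imp_continuous_on continuous_on_subset)
        show "poly h ((w z \<circ> linepath t t') u) = linepath t t' u" if "u \<in> {0..1}" for u
          using that seg local_sections_poly[OF rw z] unfolding path_image_def o_def by blast
      qed (use local_sections_centre[OF rw z] z in \<open>auto simp: pathstart_compose pathfinish_compose\<close>)
    qed
  qed auto
qed

section \<open>Families of bijections invariant under local transport\<close>

definition bijections :: "complex poly \<Rightarrow> complex \<Rightarrow> (complex \<Rightarrow> complex) set"
  where "bijections h t = {\<phi> \<in> extensional (fib h (1/2)). bij_betw \<phi> (fib h (1/2)) (fib h t)}"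

text \<open>
  Two families are used: the bijections obtained by lifting paths from \<open>1/2\<close>, and all the others.
\<close>

definition locally_constant :: "complex poly \<Rightarrow> (complex \<Rightarrow> (complex \<Rightarrow> complex) set) \<Rightarrow> bool"
  where "locally_constant h A \<longleftrightarrow> (\<forall>t. A t \<subseteq> bijections h t) \<and>
    (\<forall>t r w. local_sections h t r w \<longrightarrow>
      (\<forall>t'\<in>ball t r. A t' = compose (fib h (1/2)) (\<lambda>z. w z t') ` A t))"

lemma bijections_compose:
  assumes "\<phi> \<in> bijections h t" "bij_betw \<psi> (fib h t) (fib h t')"
  shows "compose (fib h (1/2)) \<psi> \<phi> \<in> bijections h t'"
  using assms bij_betw_compose by (auto simp: bijections_def)

lemma inj_on_compose_bijections:
  assumes "inj_on \<psi> (fib h t)"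
  shows "inj_on (compose (fib h (1/2)) \<psi>) (bijections h t)"
proof (rule inj_onI)
  fix \<phi> \<phi>' assume *: "\<phi> \<in> bijections h t" "\<phi>' \<in> bijections h t"
    "compose (fib h (1/2)) \<psi> \<phi> = compose (fib h (1/2)) \<psi> \<phi>'"
  show "\<phi> = \<phi>'"
  proof (rule extensionalityI)
    fix x assume x: "x \<in> fib h (1/2)"
    then have "\<psi> (\<phi> x) = \<psi> (\<phi>' x)"
      using * by (metis compose_eq)
    then show "\<phi> x = \<phi>' x"
      using assms * x by (auto simp: bijections_def dest: bij_betw_apply inj_onD)
  qed (use * in \<open>auto simp: bijections_def\<close>)
qed

text \<open>This gives surjectivity of the passage between nearby fibers: a map into the second
  fiber is recovered from its composite with the inverse of the transport.\<close>

lemma compose_inverse_extensional: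
  assumes "\<phi> \<in> extensional A" "bij_betw \<psi> B C" "\<And>x. x \<in> A \<Longrightarrow> \<phi> x \<in> C"
  shows "compose A \<psi> (compose A (restrict (inv_into B \<psi>) C) \<phi>) = \<phi>"
  using assms by (intro extensionalityI[of _ A]) (auto simp: compose_eq bij_betw_def f_inv_into_f)

lemma locally_constant_bijections: "locally_constant h (bijections h)"
  unfolding locally_constant_def
proof (intro conjI allI impI ballI)
  fix t t' r w assume rw: "local_sections h t r w" and t': "t' \<in> ball t r"
  note b = local_sections_bij[OF rw t']
  show "bijections h t' = compose (fib h (1/2)) (\<lambda>z. w z t') ` bijections h t"
  proof (intro equalityI subsetI)
    fix \<phi> assume \<phi>: "\<phi> \<in> bijections h t'"
    have "compose (fib h (1/2)) (restrict (inv_into (fib h t) (\<lambda>z. w z t')) (fib h t')) \<phi> \<in> bijections h t"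
      using \<phi> bij_betw_inv_into[OF b] by (intro bijections_compose[of _ _ t']) auto
    moreover have "compose (fib h (1/2)) (\<lambda>z. w z t')
        (compose (fib h (1/2)) (restrict (inv_into (fib h t) (\<lambda>z. w z t')) (fib h t')) \<phi>) = \<phi>"
      using \<phi> b by (intro compose_inverse_extensional) (auto simp: bijections_def dest: bij_betw_apply)
    ultimately show "\<phi> \<in> compose (fib h (1/2)) (\<lambda>z. w z t') ` bijections h t"
      by (metis imageI)
  qed (use bijections_compose[OF _ b] in auto)
qed auto

text \<open>A transport to \<open>t\<close> is prolonged by the segment from \<open>t\<close> to
  \<open>t'\<close>; conversely, a transport to \<open>t'\<close> is prolonged by the reversed
  segment.\<close>

lemma locally_constant_path_transports: "locally_constant h (path_transports h (1/2))"
  unfolding locally_constant_def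
proof (intro conjI allI impI ballI)
  show "path_transports h (1/2) t \<subseteq> bijections h t" for t
    by (auto simp: path_transports_def bijections_def)
  fix t t' r w assume rw: "local_sections h t r w" and t': "t' \<in> ball t r"
  note b = local_sections_bij[OF rw t']
  define \<psi> where "\<psi> = restrict (\<lambda>z. w z t') (fib h t)"
  have \<psi>: "\<psi> \<in> path_transports h t t'"
    unfolding \<psi>_def using path_transports_local[OF rw t'] .
  have eq: "compose (fib h (1/2)) \<psi> \<phi> = compose (fib h (1/2)) (\<lambda>z. w z t') \<phi>"
    if "\<phi> \<in> path_transports h (1/2) t" for \<phi>
    using that unfolding compose_def \<psi>_def path_transports_def
    by (intro restrict_ext) (auto dest: bij_betw_apply)
  show "path_transports h (1/2) t' = compose (fib h (1/2)) (\<lambda>z. w z t') ` path_transports h (1/2) t"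
  proof (intro equalityI subsetI)
    fix \<phi> assume \<phi>: "\<phi> \<in> path_transports h (1/2) t'"
    have *: "compose (fib h (1/2)) (restrict (inv_into (fib h t) \<psi>) (fib h t')) \<phi> \<in> path_transports h (1/2) t"
      using path_transports_compose[OF \<phi> path_transports_inverse[OF \<psi>]] .
    moreover have "compose (fib h (1/2)) \<psi>
        (compose (fib h (1/2)) (restrict (inv_into (fib h t) \<psi>) (fib h t')) \<phi>) = \<phi>"
      using \<phi> \<psi> by (intro compose_inverse_extensional) (auto simp: path_transports_def dest: bij_betw_apply)
    ultimately show "\<phi> \<in> compose (fib h (1/2)) (\<lambda>z. w z t') ` path_transports h (1/2) t"
      using eq[OF *] by (metis imageI)
  next
    fix \<phi> assume "\<phi> \<in> compose (fib h (1/2)) (\<lambda>z. w z t') ` path_transports h (1/2) t"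
    then show "\<phi> \<in> path_transports h (1/2) t'"
      using eq path_transports_compose[OF _ \<psi>] by force
  qed
qed

text \<open>Composition with the branches is injective on bijections, hence taking images respects
  set differences. This makes the complement of the path transports available as a second
  family.\<close>

lemma locally_constant_diff:
  assumes "locally_constant h A" "locally_constant h A'"
  shows "locally_constant h (\<lambda>t. A t - A' t)"
  unfolding locally_constant_def
proof (intro conjI allI impI ballI)
  show "A t - A' t \<subseteq> bijections h t" for t
    using assms by (auto simp: locally_constant_def)
  fix t t' r w assume rw: "local_sections h t r w" and t': "t' \<in> ball t r"
  have "inj_on (compose (fib h (1/2)) (\<lambda>z. w z t')) (A t \<union> A' t)"
    using inj_on_compose_bijections[OF bij_betw_imp_inj_on[OF local_sections_bij[OF rw t']]]
    by (rule inj_on_subset) (use assms in \<open>auto simp: locally_constant_def\<close>)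
  then show "A t' - A' t' = compose (fib h (1/2)) (\<lambda>z. w z t') ` (A t - A' t)"
    using assms rw t' inj_on_image_set_diff[of _ "A t \<union> A' t" "A t" "A' t"]
    unfolding locally_constant_def by (metis Diff_subset sup.cobounded2 sup.coboundedI1)
qed

section \<open>Resolvents\<close>

lemma holomorphic_coeff_prod_linear:
  assumes "\<And>i. i \<in> I \<Longrightarrow> v i holomorphic_on U"
  shows "(\<lambda>t. coeff (\<Prod>i\<in>I. [:- v i t, 1:]) k) holomorphic_on U"
  using assms
proof (induction I arbitrary: k rule: infinite_finite_induct)
  case (insert i I)
  have eq: "(\<lambda>t. coeff (\<Prod>i\<in>insert i I. [:- v i t, 1:]) k) =
    (\<lambda>t. - v i t * coeff (\<Prod>i\<in>I. [:- v i t, 1:]) k +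
      (case k of 0 \<Rightarrow> 0 | Suc m \<Rightarrow> coeff (\<Prod>i\<in>I. [:- v i t, 1:]) m))"
    using insert.hyps by (auto simp: coeff_pCons split: nat.splits)
  show ?case
    unfolding eq using insert by (cases k) (auto intro!: holomorphic_intros)
qed auto

text \<open>Each further linear factor enlarges the bound on the coefficients by a factor of at most
  \<open>1 + M\<close>.\<close>

lemma norm_coeff_prod_linear_le:
  fixes v :: "'i \<Rightarrow> 'a::{real_normed_field}"
  assumes "\<And>i. i \<in> I \<Longrightarrow> norm (v i) \<le> M" "M \<ge> 0"
  shows "norm (coeff (\<Prod>i\<in>I. [:- v i, 1:]) k) \<le> (1 + M) ^ card I"
  using assms(1)
proof (induction I arbitrary: k rule: infinite_finite_induct)
  case (insert i I)
  let ?p = "\<Prod>i\<in>I. [:- v i, 1:]"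
  have *: "norm (coeff ?p k) \<le> (1 + M) ^ card I" for k
    using insert by auto
  have "coeff (\<Prod>i\<in>insert i I. [:- v i, 1:]) k =
      - v i * coeff ?p k + (case k of 0 \<Rightarrow> 0 | Suc m \<Rightarrow> coeff ?p m)"
    using insert.hyps by (auto simp: coeff_pCons split: nat.splits)
  also have "norm \<dots> \<le> norm (v i) * norm (coeff ?p k) + (1 + M) ^ card I"
    using * assms(2) by (intro order_trans[OF norm_triangle_ineq] add_mono)
      (auto simp: norm_mult split: nat.splits)
  also have "\<dots> \<le> M * (1 + M) ^ card I + (1 + M) ^ card I"
    using * assms(2) insert.prems by (intro add_right_mono mult_mono) auto
  also have "\<dots> = (1 + M) ^ card (insert i I)"
    using insert.hyps by (simp add: algebra_simps)
  finally show ?case .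
qed (use assms(2) in \<open>auto simp: coeff_1\<close>)

text \<open>The bound makes \<open>0\<close> and \<open>1\<close> removable singularities, and
  Liouville's theorem turns an entire function of polynomial growth into a polynomial.\<close>

lemma polynomial_if_growth:
  assumes hol: "f holomorphic_on (- {0, 1})"
    and bound: "\<And>t. t \<notin> {0, 1} \<Longrightarrow> norm (f t) \<le> (K * (1 + norm t)) ^ N" and K: "K \<ge> 0"
  obtains p where "\<And>t. t \<notin> {0, 1::complex} \<Longrightarrow> f t = poly p t"
proof -
  have "f \<in> O[at z](\<lambda>_. 1)" if "z \<in> {0, 1}" for z
  proof (rule bigoI)
    have "\<forall>\<^sub>F t in at z. t \<in> ball z 1 - {z}"
      by (intro eventually_at_in_open) auto
    then show "\<forall>\<^sub>F t in at z. norm (f t) \<le> (K * 3) ^ N * norm (1::complex)"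
    proof eventually_elim
      case (elim t)
      have "t \<notin> {0, 1}"
        using elim that by auto
      moreover have "norm t \<le> 2"
        using elim that norm_triangle_ineq[of z "t - z"] by (auto simp: dist_norm norm_minus_commute)
      then have "(K * (1 + norm t)) ^ N \<le> (K * 3) ^ N"
        using K by (intro power_mono mult_left_mono) auto
      ultimately show ?case
        using bound[of t] by simp
    qed
  qed
  then obtain g where g: "g holomorphic_on UNIV" "\<And>z. z \<notin> {0, 1} \<Longrightarrow> g z = f z"
    using removable_singularities[of "{0, 1}" UNIV f] hol by (auto simp: Compl_eq_Diff_UNIV)
  \<comment> \<open>For \<open>2 \<le> norm t\<close> the point avoids \<open>0\<close> and
    \<open>1\<close>, and \<open>1 + norm t\<close> is at most \<open>2 * norm t\<close>; this
    brings the bound into the form of a constant times a power.\<close>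
  have "norm (g t) \<le> (K * 2) ^ N * norm t ^ N" if "2 \<le> norm t" for t :: complex
  proof -
    have "t \<notin> {0, 1}" using that by auto
    then have "norm (g t) \<le> (K * (1 + norm t)) ^ N"
      using g bound by simp
    also have "\<dots> \<le> (K * (2 * norm t)) ^ N"
      using that K by (intro power_mono mult_left_mono) auto
    finally show ?thesis by (simp add: power_mult_distrib algebra_simps)
  qed
  then have L: "g t = (\<Sum>k\<le>N. (deriv ^^ k) g 0 / fact k * t ^ k)" for t
    by (rule Liouville_polynomial[OF g(1)])
  define p where "p = (\<Sum>k\<le>N. monom ((deriv ^^ k) g 0 / fact k) k)"
  have "f t = poly p t" if "t \<notin> {0, 1}" for t
    using L[of t] g(2)[OF that] by (simp add: p_def poly_sum poly_monom)
  then show ?thesis by (rule that)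
qed

text \<open>Write \<open>h\<close> as \<open>a + z * (b + z * q)\<close> with \<open>q\<close>
  nonzero. For large \<open>z\<close> the factor in parentheses has norm at least \<open>2\<close>,
  so \<open>norm (poly h z)\<close> is at least \<open>2 * norm z - norm a\<close>, and hence at
  least \<open>norm z\<close> once \<open>norm z\<close> exceeds \<open>norm a\<close>.\<close>

lemma poly_preimage_growth:
  fixes h :: "complex poly"
  assumes "degree h \<ge> 2"
  obtains K where "K \<ge> 0" "\<And>z. norm z \<le> K * (1 + norm (poly h z))"
proof -
  obtain a b q where h: "h = pCons a (pCons b q)"
    by (metis pCons_cases)
  have "q \<noteq> 0"
    using assms unfolding h by (auto split: if_splits)
  then obtain r where r: "\<And>z. r \<le> norm z \<Longrightarrow> 2 \<le> norm (poly (pCons b q) z)"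
    using poly_infinity[of q 2 b] by blast
  define K where "K = max 1 (max r (norm a))"
  have "norm z \<le> K * (1 + norm (poly h z))" for z
  proof (cases "norm z \<le> K")
    case True
    have "K * 1 \<le> K * (1 + norm (poly h z))"
      by (intro mult_left_mono) (auto simp: K_def)
    then show ?thesis using True by simp
  next
    case False
    have "norm z * 2 \<le> norm z * norm (poly (pCons b q) z)"
      using r[of z] False by (intro mult_left_mono) (auto simp: K_def)
    also have "\<dots> = norm (z * poly (pCons b q) z)"
      by (simp only: norm_mult)
    also have "z * poly (pCons b q) z = poly h z - a"
      by (simp add: h)
    also have "norm (poly h z - a) \<le> norm (poly h z) + norm a"
      by (rule norm_triangle_ineq4)
    finally have "norm z \<le> norm (poly h z)"
      using False by (simp add: K_def)
    also have "\<dots> \<le> K * norm (poly h z)"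
      by (simp add: K_def mult_le_cancel_right1)
    also have "\<dots> \<le> K * (1 + norm (poly h z))"
      by (intro mult_left_mono) (auto simp: K_def)
    finally show ?thesis .
  qed
  then show ?thesis
    by (intro that[of K]) (auto simp: K_def)
qed

definition linear_form :: "complex poly \<Rightarrow> (complex \<Rightarrow> complex) \<Rightarrow> (complex \<Rightarrow> complex) \<Rightarrow> complex"
  where "linear_form h a \<phi> = (\<Sum>x\<in>fib h (1/2). a x * \<phi> x)"

text \<open>The product over the set \<open>A t\<close> involves no choice of branches. This is why
  its coefficients are single-valued in \<open>t\<close> although the individual roots are
  not.\<close>

definition resolvent ::
    "complex poly \<Rightarrow> (complex \<Rightarrow> complex) \<Rightarrow> (complex \<Rightarrow> (complex \<Rightarrow> complex) set) \<Rightarrow> complex \<Rightarrow> complex poly"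
  where "resolvent h a A t = (\<Prod>\<phi>\<in>A t. [:- linear_form h a \<phi>, 1:])"

lemma half_notin: "(1/2 :: complex) \<notin> {0, 1}"
  by auto

text \<open>The point is a bound independent of \<open>t\<close>: it provides one exponent for the
  growth estimate and one degree bound for all resolvents.\<close>

lemma bijections_card:
  assumes "belyi h" "t \<notin> {0, 1}"
  shows "finite (bijections h t)" "card (bijections h t) \<le> degree h ^ degree h"
proof -
  have sub: "bijections h t \<subseteq> fib h (1/2) \<rightarrow>\<^sub>E fib h t"
    by (auto simp: bijections_def PiE_def dest: bij_betw_apply)
  have fin: "finite (fib h (1/2) \<rightarrow>\<^sub>E fib h t)"
    using fib_finite[OF assms(1)] assms(2) half_notin by (intro finite_PiE) auto
  then show "finite (bijections h t)"
    using sub finite_subset by blast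
  have "card (fib h (1/2) \<rightarrow>\<^sub>E fib h t) = degree h ^ degree h"
    using fib_finite[OF assms(1) half_notin] fib_card[OF assms(1)] assms(2) half_notin
    by (simp add: card_PiE)
  then show "card (bijections h t) \<le> degree h ^ degree h"
    using card_mono[OF fin sub] by simp
qed

lemma locally_constant_finite:
  assumes "belyi h" "t \<notin> {0, 1}" "locally_constant h A"
  shows "finite (A t)" "card (A t) \<le> degree h ^ degree h"
proof -
  have sub: "A t \<subseteq> bijections h t"
    using assms(3) by (auto simp: locally_constant_def)
  show "finite (A t)" "card (A t) \<le> degree h ^ degree h"
    using finite_subset[OF sub] card_mono[OF _ sub] bijections_card[OF assms(1,2)] by auto
qed

lemma poly_resolvent: "poly (resolvent h a A t) T = (\<Prod>\<phi>\<in>A t. T - linear_form h a \<phi>)"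
  by (simp add: resolvent_def poly_prod)

lemma degree_resolvent:
  assumes "belyi h" "t \<notin> {0, 1}" "locally_constant h A"
  shows "degree (resolvent h a A t) \<le> degree h ^ degree h"
proof -
  have "degree (resolvent h a A t) \<le> (\<Sum>\<phi>\<in>A t. degree [:- linear_form h a \<phi>, 1:])"
    unfolding resolvent_def using locally_constant_finite[OF assms] by (intro degree_prod_sum_le[unfolded o_def]) auto
  then show ?thesis
    using locally_constant_finite[OF assms] by simp
qed

text \<open>Near \<open>t\<close> the set \<open>A t'\<close> is \<open>A t\<close> composed with
  the branches, so the resolvent is a product over the fixed index set \<open>A t\<close> of factors
  holomorphic in \<open>t'\<close>. By \<open>poly_preimage_growth\<close> its roots grow at most
  linearly in \<open>t\<close>, and \<open>polynomial_if_growth\<close> applies.\<close>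

lemma coeff_resolvent_polynomial:
  assumes h: "belyi h" and A: "locally_constant h A"
  obtains c where "\<And>k t. t \<notin> {0, 1} \<Longrightarrow> coeff (resolvent h a A t) k = poly (c k) t"
proof -
  define F where "F = fib h (1/2)"
  have F: "finite F"
    using fib_finite[OF h half_notin] by (simp add: F_def)
  obtain K where K: "K \<ge> 0" "\<And>z. norm z \<le> K * (1 + norm (poly h z))"
    using poly_preimage_growth h by (auto simp: belyi_def)
  define L where "L = (\<Sum>x\<in>F. norm (a x)) * K"
  have L: "L \<ge> 0"
    unfolding L_def using K by (intro mult_nonneg_nonneg sum_nonneg) auto
  have lf: "norm (linear_form h a \<phi>) \<le> L * (1 + norm t)" if "\<phi> \<in> A t" for \<phi> t
  proof -
    have \<phi>: "poly h (\<phi> x) = t" if "x \<in> F" for x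
      using that \<open>\<phi> \<in> A t\<close> A by (auto simp: locally_constant_def bijections_def F_def fib_def dest!: bij_betw_apply)
    have "norm (linear_form h a \<phi>) \<le> (\<Sum>x\<in>F. norm (a x * \<phi> x))"
      unfolding linear_form_def F_def by (rule norm_sum)
    also have "\<dots> \<le> (\<Sum>x\<in>F. norm (a x) * (K * (1 + norm t)))"
      using K(2) \<phi> by (intro sum_mono) (metis mult_left_mono norm_ge_zero norm_mult)
    also have "\<dots> = L * (1 + norm t)"
      by (simp add: L_def sum_distrib_right mult.assoc)
    finally show ?thesis .
  qed
  have "\<exists>p. \<forall>t. t \<notin> {0, 1} \<longrightarrow> coeff (resolvent h a A t) k = poly p t" for k
  proof -
    have "(\<lambda>t. coeff (resolvent h a A t) k) holomorphic_on (- {0, 1})"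
    proof -
      have "(\<lambda>t. coeff (resolvent h a A t) k) field_differentiable at t" if t: "t \<notin> {0, 1}" for t
      proof -
        obtain r w where rw: "local_sections h t r w"
          using local_sections_exist[OF h t] by blast
        have A': "A t' = compose F (\<lambda>z. w z t') ` A t" if "t' \<in> ball t r" for t'
          using A rw that by (auto simp: locally_constant_def F_def)
        have inF: "\<phi> x \<in> fib h t" if "\<phi> \<in> A t" "x \<in> F" for \<phi> x
          using that A by (auto simp: locally_constant_def bijections_def F_def dest!: bij_betw_apply)
        define v where "v \<phi> t' = (\<Sum>x\<in>F. a x * w (\<phi> x) t')" for \<phi> t'
        have res: "resolvent h a A t' = (\<Prod>\<phi>\<in>A t. [:- v \<phi> t', 1:])" if t': "t' \<in> ball t r" for t'
        proof -
          have "inj_on (compose F (\<lambda>z. w z t')) (A t)"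
            unfolding F_def
            using inj_on_compose_bijections[OF bij_betw_imp_inj_on[OF local_sections_bij[OF rw t']]]
            by (rule inj_on_subset) (use A in \<open>auto simp: locally_constant_def\<close>)
          moreover have "linear_form h a (compose F (\<lambda>z. w z t') \<phi>) = v \<phi> t'" for \<phi>
            by (simp add: linear_form_def F_def v_def compose_eq)
          ultimately show ?thesis
            unfolding resolvent_def A'[OF t'] by (simp add: prod.reindex)
        qed
        have "v \<phi> holomorphic_on ball t r" if "\<phi> \<in> A t" for \<phi>
          unfolding v_def using local_sections_holomorphic[OF rw inF[OF that]]
          by (intro holomorphic_intros) auto
        then have "(\<lambda>t'. coeff (\<Prod>\<phi>\<in>A t. [:- v \<phi> t', 1:]) k) holomorphic_on ball t r"
          by (rule holomorphic_coeff_prod_linear)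
        then have "(\<lambda>t. coeff (resolvent h a A t) k) holomorphic_on ball t r"
          by (rule holomorphic_transform) (simp add: res)
        then show ?thesis
          using local_sections_pos[OF rw] by (intro holomorphic_on_imp_differentiable_at[of _ "ball t r"]) auto
      qed
      then show ?thesis
        by (auto simp: holomorphic_on_def intro: field_differentiable_at_within)
    qed
    moreover have "norm (coeff (resolvent h a A t) k) \<le> ((1 + L) * (1 + norm t)) ^ (degree h ^ degree h)"
      if t: "t \<notin> {0, 1}" for t
    proof -
      have "norm (coeff (resolvent h a A t) k) \<le> (1 + L * (1 + norm t)) ^ card (A t)"
        unfolding resolvent_def using lf L by (intro norm_coeff_prod_linear_le) auto
      also have "\<dots> \<le> ((1 + L) * (1 + norm t)) ^ card (A t)"
        using L by (intro power_mono) (auto simp: algebra_simps)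
      \<comment> \<open>The exponent is raised to one that does not depend on \<open>t\<close>,
        which requires the base to be at least \<open>1\<close>.\<close>
      also have "\<dots> \<le> ((1 + L) * (1 + norm t)) ^ (degree h ^ degree h)"
      proof (intro power_increasing)
        have "1 * 1 \<le> (1 + L) * (1 + norm t)"
          using L by (intro mult_mono) auto
        then show "1 \<le> (1 + L) * (1 + norm t)" by simp
      qed (rule locally_constant_finite(2)[OF h t A])
      finally show ?thesis .
    qed
    ultimately show ?thesis
      using polynomial_if_growth[of "\<lambda>t. coeff (resolvent h a A t) k" "1 + L" "degree h ^ degree h"] L
      by (metis add_nonneg_nonneg zero_le_one)
  qed
  then obtain c where "\<And>k t. t \<notin> {0, 1} \<Longrightarrow> coeff (resolvent h a A t) k = poly (c k) t"
    by metis
  then show ?thesis by (rule that)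
qed

lemma infinite_Rats_minus: "finite X \<Longrightarrow> infinite (\<rat> - X :: complex set)"
  using Diff_infinite_finite infinite_super[OF Nats_subset_Rats Nats_infinite] by blast

lemma fib_Qbar:
  assumes h: "belyi h" and hQ: "\<And>i. coeff h i \<in> Qbar" and t: "t \<in> Qbar"
  shows "fib h t \<subseteq> Qbar"
proof
  fix z assume z: "z \<in> fib h t"
  define p where "p = h - [:t:]"
  have "degree h \<noteq> 0"
    using h by (simp add: belyi_def)
  then have "p \<noteq> 0"
    unfolding p_def by (metis degree_pCons_0 eq_iff_diff_eq_0)
  moreover have "algebraic (coeff p i)" for i
    using Qbar_diff[OF hQ t] hQ by (auto simp: p_def Qbar_def coeff_pCons split: nat.splits)
  moreover have "poly p z = 0"
    using z by (simp add: p_def fib_def)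
  ultimately show "z \<in> Qbar"
    using algebraic_poly_root unfolding Qbar_def by blast
qed

text \<open>Over a rational \<open>t\<close> outside \<open>{0, 1}\<close> the fiber is algebraic,
  so \<open>c k\<close> takes an algebraic value there, and infinitely many such values force
  algebraic coefficients.\<close>

lemma coeff_resolvent_Qbar:
  assumes h: "belyi h" and A: "locally_constant h A" and hQ: "\<And>i. coeff h i \<in> Qbar"
    and a: "\<And>x. a x \<in> Qbar"
    and c: "\<And>k t. t \<notin> {0, 1} \<Longrightarrow> coeff (resolvent h a A t) k = poly (c k) t"
  shows "coeff (c k) i \<in> Qbar"
proof (rule Qbar_coeffs_by_values)
  show "infinite (\<rat> - {0, 1 :: complex})"
    by (intro infinite_Rats_minus) auto
  show "\<rat> - {0, 1} \<subseteq> Qbar"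
    using Qbar_Rats by blast
  fix t :: complex assume t: "t \<in> \<rat> - {0, 1}"
  have "linear_form h a \<phi> \<in> Qbar" if "\<phi> \<in> A t" for \<phi>
    unfolding linear_form_def
  proof (intro Qbar_sum Qbar_mult a)
    fix x assume "x \<in> fib h (1/2)"
    then have "\<phi> x \<in> fib h t"
      using that A by (auto simp: locally_constant_def bijections_def dest!: bij_betw_apply)
    then show "\<phi> x \<in> Qbar"
      using fib_Qbar[OF h hQ] Qbar_Rats t by blast
  qed
  then show "poly (c k) t \<in> Qbar"
    using t c[of t k, symmetric] Qbar_coeff_prod_linear unfolding resolvent_def by auto
qed

section \<open>Galois conjugation\<close>

lemma
  assumes "\<sigma> \<in> Gal_Qbar"
  shows Gal_bij: "bij_betw \<sigma> Qbar Qbar"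
    and Gal_add: "x \<in> Qbar \<Longrightarrow> y \<in> Qbar \<Longrightarrow> \<sigma> (x + y) = \<sigma> x + \<sigma> y"
    and Gal_mult: "x \<in> Qbar \<Longrightarrow> y \<in> Qbar \<Longrightarrow> \<sigma> (x * y) = \<sigma> x * \<sigma> y"
    and Gal_Rats: "q \<in> \<rat> \<Longrightarrow> \<sigma> q = q"
  using assms by (auto simp: Gal_Qbar_def)

lemma Gal_Qbar_closed: "\<sigma> \<in> Gal_Qbar \<Longrightarrow> x \<in> Qbar \<Longrightarrow> \<sigma> x \<in> Qbar"
  using Gal_bij bij_betw_apply by metis

lemma Gal_eq_iff: "\<sigma> \<in> Gal_Qbar \<Longrightarrow> x \<in> Qbar \<Longrightarrow> y \<in> Qbar \<Longrightarrow> \<sigma> x = \<sigma> y \<longleftrightarrow> x = y"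
  using Gal_bij bij_betw_imp_inj_on inj_on_eq_iff by metis

lemma Gal_0: "\<sigma> \<in> Gal_Qbar \<Longrightarrow> \<sigma> 0 = 0"
  by (simp add: Gal_Rats)

lemma Gal_sum:
  assumes "\<sigma> \<in> Gal_Qbar" "\<And>i. i \<in> I \<Longrightarrow> v i \<in> Qbar"
  shows "\<sigma> (\<Sum>i\<in>I. v i) = (\<Sum>i\<in>I. \<sigma> (v i))"
  using assms(2)
  by (induction I rule: infinite_finite_induct) (auto simp: Gal_0[OF assms(1)] Gal_add[OF assms(1)] Qbar_sum)

lemma Gal_power:
  assumes "\<sigma> \<in> Gal_Qbar" "x \<in> Qbar"
  shows "\<sigma> (x ^ n) = \<sigma> x ^ n"
  using assms by (induction n) (auto simp: Gal_Rats Gal_mult Qbar_power)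

lemma Gal_poly:
  assumes "\<sigma> \<in> Gal_Qbar" "x \<in> Qbar" "\<And>i. coeff p i \<in> Qbar"
  shows "\<sigma> (poly p x) = poly (map_poly \<sigma> p) (\<sigma> x)"
  using assms(3)
proof (induction p)
  case (pCons a p)
  have "a \<in> Qbar" "\<And>i. coeff p i \<in> Qbar"
    using pCons.prems[of 0] pCons.prems[of "Suc i" for i] by simp_all
  then show ?case
    using pCons.IH assms(1,2)
    by (simp add: map_poly_pCons Gal_0 Gal_add Gal_mult Qbar_mult Qbar_poly)
qed (simp add: Gal_0[OF assms(1)])

lemma Gal_coeff_map_poly:
  assumes "\<sigma> \<in> Gal_Qbar" "\<And>i. coeff p i \<in> Qbar"
  shows "coeff (map_poly \<sigma> p) i \<in> Qbar"
  using assms by (simp add: coeff_map_poly Gal_0 Gal_Qbar_closed)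

text \<open>A rational base point is fixed by \<open>\<sigma>\<close>, and both fibers lie in
  \<open>Qbar\<close>, where \<open>\<sigma>\<close> is bijective and so both preserves and reflects
  the equation of the fiber.\<close>

lemma Gal_fib:
  assumes \<sigma>: "\<sigma> \<in> Gal_Qbar" and h: "belyi h" "\<And>i. coeff h i \<in> Qbar" and g: "belyi (map_poly \<sigma> h)"
    and q: "q \<in> \<rat>"
  shows "bij_betw \<sigma> (fib h q) (fib (map_poly \<sigma> h) q)"
proof (rule bij_betw_imageI)
  have sub: "fib h q \<subseteq> Qbar" "fib (map_poly \<sigma> h) q \<subseteq> Qbar"
    using fib_Qbar[OF h] fib_Qbar[OF g Gal_coeff_map_poly[OF \<sigma> h(2)]] Qbar_Rats[OF q] by auto
  show "inj_on \<sigma> (fib h q)"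
    using sub Gal_eq_iff[OF \<sigma>] by (intro inj_onI) blast
  show "\<sigma> ` fib h q = fib (map_poly \<sigma> h) q"
  proof (intro equalityI subsetI)
    fix y assume y: "y \<in> fib (map_poly \<sigma> h) q"
    then obtain x where x: "x \<in> Qbar" "y = \<sigma> x"
      using sub bij_betw_imp_surj_on[OF Gal_bij[OF \<sigma>]] by blast
    have "\<sigma> (poly h x) = \<sigma> q"
      using y x Gal_poly[OF \<sigma> x(1) h(2)] Gal_Rats[OF \<sigma> q] by (simp add: fib_def)
    then have "x \<in> fib h q"
      using Gal_eq_iff[OF \<sigma>] Qbar_poly[OF h(2) x(1)] Qbar_Rats[OF q] by (simp add: fib_def)
    then show "y \<in> \<sigma> ` fib h q" using x by blast
  next
    fix y assume "y \<in> \<sigma> ` fib h q"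
    then show "y \<in> fib (map_poly \<sigma> h) q"
      using Gal_poly[OF \<sigma> _ h(2)] Gal_Rats[OF \<sigma> q] sub by (force simp: fib_def)
  qed
qed

text \<open>Take \<open>a x = m ^ idx x\<close> for an injective numbering \<open>idx\<close> of
  \<open>F\<close>. For \<open>\<phi> \<noteq> \<psi>\<close> the two sums differ by the value at
  \<open>m\<close> of the nonzero polynomial \<open>p \<phi> \<psi>\<close>, and some natural number
  \<open>m\<close> avoids the finitely many roots of all these polynomials.\<close>

lemma separating_coefficients:
  fixes F :: "'a set" and D :: "('a \<Rightarrow> 'b::field_char_0) set"
  assumes "finite F" "finite D" "D \<subseteq> extensional F"
  obtains a :: "'a \<Rightarrow> 'b" where "\<And>x. a x \<in> \<rat>" "inj_on (\<lambda>\<phi>. \<Sum>x\<in>F. a x * \<phi> x) D"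
proof -
  have "\<exists>idx :: 'a \<Rightarrow> nat. inj_on idx F"
    using finite_imp_inj_to_nat_seg[OF assms(1)] by fast
  then obtain idx :: "'a \<Rightarrow> nat" where idx: "inj_on idx F" ..
  define p where "p \<phi> \<psi> = (\<Sum>x\<in>F. monom (\<phi> x - \<psi> x) (idx x))" for \<phi> \<psi> :: "'a \<Rightarrow> 'b"
  have p0: "p \<phi> \<psi> \<noteq> 0" if "\<phi> \<in> D" "\<psi> \<in> D" "\<phi> \<noteq> \<psi>" for \<phi> \<psi>
  proof -
    have "\<exists>y\<in>F. \<phi> y \<noteq> \<psi> y"
      using extensionalityI[of \<phi> F \<psi>] that assms(3) by blast
    then obtain y where y: "y \<in> F" "\<phi> y \<noteq> \<psi> y" ..
    have "coeff (p \<phi> \<psi>) (idx y) = (\<Sum>x\<in>F. if x = y then \<phi> x - \<psi> x else 0)"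
      unfolding p_def coeff_sum coeff_monom
      using idx y by (intro sum.cong) (auto simp: inj_on_def)
    also have "\<dots> = \<phi> y - \<psi> y"
      using y assms(1) by simp
    finally show ?thesis using y by auto
  qed
  define R where "R = (\<Union>\<phi>\<in>D. \<Union>\<psi>\<in>D - {\<phi>}. {z. poly (p \<phi> \<psi>) z = 0})"
  have "finite R"
    unfolding R_def using assms(2) p0 by (intro finite_UN_I) (auto intro!: poly_roots_finite)
  then obtain m :: 'b where m: "m \<in> \<nat>" "m \<notin> R"
    using Nats_infinite[where 'a='b] finite_subset[of \<nat> R] by blast
  define a where "a x = m ^ idx x" for x
  show ?thesis
  proof (rule that[of a])
    show "a x \<in> \<rat>" for x
      using m(1) Nats_subset_Rats by (auto simp: a_def)
    show "inj_on (\<lambda>\<phi>. \<Sum>x\<in>F. a x * \<phi> x) D"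
    proof (rule inj_onI, rule ccontr)
      fix \<phi> \<psi> assume *: "\<phi> \<in> D" "\<psi> \<in> D" "(\<Sum>x\<in>F. a x * \<phi> x) = (\<Sum>x\<in>F. a x * \<psi> x)" "\<phi> \<noteq> \<psi>"
      have "poly (p \<phi> \<psi>) m = (\<Sum>x\<in>F. a x * \<phi> x) - (\<Sum>x\<in>F. a x * \<psi> x)"
        by (simp add: p_def poly_sum poly_monom a_def sum_subtractf[symmetric] algebra_simps)
      then have "m \<in> R"
        using * by (auto simp: R_def)
      then show False using m by blast
    qed
  qed
qed

text \<open>Here \<open>e T t\<close> is the resolvent with \<open>\<sigma>\<close> applied to its coefficients.\<close>

lemma conjugate_resolvent:
  assumes \<sigma>: "\<sigma> \<in> Gal_Qbar" and h: "belyi h" "\<And>i. coeff h i \<in> Qbar" and A: "locally_constant h A"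
    and a: "\<And>x. a x \<in> Qbar"
  obtains e :: "complex \<Rightarrow> complex \<Rightarrow> complex" where
    "\<And>u U. u holomorphic_on U \<Longrightarrow> (\<lambda>t. e (u t) t) holomorphic_on U"
    "\<And>T t. T \<in> Qbar \<Longrightarrow> t \<in> \<rat> - {0, 1} \<Longrightarrow> e (\<sigma> T) t = 0 \<longleftrightarrow> (\<exists>\<phi>\<in>A t. T = linear_form h a \<phi>)"
proof -
  obtain c where c: "\<And>k t. t \<notin> {0, 1} \<Longrightarrow> coeff (resolvent h a A t) k = poly (c k) t"
    using coeff_resolvent_polynomial[OF h(1) A] by metis
  note cQ = coeff_resolvent_Qbar[OF h(1) A h(2) a c]
  define N where "N = degree h ^ degree h"
  \<comment> \<open>The length \<open>N\<close> of the sum is independent of \<open>t\<close>. Thus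
    \<open>e\<close> is a polynomial expression in both arguments, defined for all complex
    \<open>T\<close> and \<open>t\<close>, while the comparison with \<open>\<sigma>\<close> is made
    only at algebraic \<open>T\<close> and rational \<open>t\<close>.\<close>
  define e where "e T t = (\<Sum>k\<le>N. poly (map_poly \<sigma> (c k)) t * T ^ k)" for T t
  show ?thesis
  proof (rule that[of e])
    show "(\<lambda>t. e (u t) t) holomorphic_on U" if "u holomorphic_on U" for u U
      unfolding e_def by (intro holomorphic_intros that)
    fix T t :: complex assume T: "T \<in> Qbar" and t: "t \<in> \<rat> - {0, 1}"
    have tQ: "t \<in> Qbar"
      using t Qbar_Rats by blast
    have "poly (resolvent h a A t) T = (\<Sum>k\<le>N. coeff (resolvent h a A t) k * T ^ k)"
      unfolding poly_altdef
      using degree_resolvent[OF h(1) _ A, of t a] t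
      by (intro sum.mono_neutral_left) (auto simp: N_def coeff_eq_0)
    also have "\<dots> = (\<Sum>k\<le>N. poly (c k) t * T ^ k)"
      using c t by simp
    \<comment> \<open>Since \<open>t\<close> is rational, \<open>\<sigma> t = t\<close>, so
      \<open>\<sigma>\<close> acts only on \<open>T\<close> and on the coefficients of
      \<open>c k\<close>.\<close>
    also have "\<sigma> \<dots> = e (\<sigma> T) t"
      unfolding e_def
      using T tQ t cQ
      by (simp add: Gal_sum[OF \<sigma>] Gal_mult[OF \<sigma>] Gal_power[OF \<sigma>] Gal_poly[OF \<sigma>] Gal_Rats[OF \<sigma>]
          Qbar_mult Qbar_power Qbar_poly)
    finally have "e (\<sigma> T) t = \<sigma> (poly (resolvent h a A t) T)" ..
    moreover have "poly (resolvent h a A t) T \<in> Qbar"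
      using T tQ t c by (intro Qbar_poly) (auto intro: Qbar_poly cQ)
    ultimately have "e (\<sigma> T) t = 0 \<longleftrightarrow> poly (resolvent h a A t) T = 0"
      using Gal_eq_iff[OF \<sigma>, of _ 0] Gal_0[OF \<sigma>] Qbar_Rats[of 0] by simp
    also have "\<dots> \<longleftrightarrow> (\<exists>\<phi>\<in>A t. T = linear_form h a \<phi>)"
      using locally_constant_finite(1)[OF h(1) _ A] t by (simp add: poly_resolvent)
    finally show "e (\<sigma> T) t = 0 \<longleftrightarrow> (\<exists>\<phi>\<in>A t. T = linear_form h a \<phi>)" .
  qed
qed

section \<open>Analytic continuation along a loop\<close>

lemma holomorphic_zero_if_eventually:
  assumes "f holomorphic_on U" "open U" "connected U" "t1 \<in> U" "\<forall>\<^sub>F t in at t1. f t = 0" "t \<in> U"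
  shows "f t = 0"
proof (rule analytic_continuation[OF assms(1-3), of "{t \<in> U. f t = 0}" t1])
  have "\<forall>\<^sub>F t in at t1. t \<in> U"
    using assms(2,4) by (rule eventually_at_in_open')
  then have "\<forall>\<^sub>F t in at t1. t \<in> {t \<in> U. f t = 0}"
    using assms(5) by eventually_elim simp
  then show "t1 islimpt {t \<in> U. f t = 0}"
    by (simp add: islimpt_conv_frequently_at eventually_frequently)
qed (use assms in auto)

text \<open>An instance of \<open>local_sections_lift\<close>, with the identity of the disc in
  place of the path and the branch \<open>w z\<close> as its lift.\<close>

lemma local_sections_agree:
  assumes g: "belyi g" and rw: "local_sections g t0 r w" and rw1: "local_sections g t1 r1 w1"
    and t1: "t1 \<in> ball t0 r" and z: "z \<in> fib g t0"
  shows "\<forall>\<^sub>F t in at t1. w z t = w1 (w z t1) t"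
proof -
  have "at t1 within ball t0 r = at t1"
    using t1 by (intro at_within_open) auto
  moreover have "\<forall>\<^sub>F u in at t1 within ball t0 r. w z u = w1 (w z t1) u"
  proof (rule local_sections_lift[OF g rw1, of _ _ _ _ "\<lambda>u. u"])
    show "w z t1 \<in> fib g t1"
      using local_sections_bij[OF rw t1] z by (rule bij_betw_apply)
    show "continuous (at t1 within ball t0 r) (w z)"
      using local_sections_holomorphic[OF rw z] t1
      by (auto dest!: holomorphic_on_imp_continuous_on simp: continuous_on_eq_continuous_within)
    show "poly g (w z u) = u" if "u \<in> ball t0 r" for u
      using local_sections_poly[OF rw z that] .
  qed (use t1 in auto)
  ultimately show ?thesis by simp
qed

text \<open>Near \<open>t1\<close> both expressions are the same function, and the identity theorem
  spreads vanishing from there to either disc. Analyticity of \<open>e\<close> in two variables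
  enters only through the rule that substituting a holomorphic function yields a holomorphic
  function.\<close>

lemma vanishing_transfer:
  assumes g: "belyi g" and rw: "local_sections g t0 r w" and rw1: "local_sections g t1 r1 w1"
    and t1: "t1 \<in> ball t0 r" and z: "\<And>x. x \<in> F \<Longrightarrow> z x \<in> fib g t0" and F: "finite F"
    and e: "\<And>u U. u holomorphic_on U \<Longrightarrow> (\<lambda>t. e (u t) t) holomorphic_on U"
  shows "(\<forall>t\<in>ball t0 r. e (\<Sum>x\<in>F. a x * w (z x) t) t = 0) \<longleftrightarrow>
    (\<forall>t\<in>ball t1 r1. e (\<Sum>x\<in>F. a x * w1 (w (z x) t1) t) t = (0::complex))"
    (is "(\<forall>t\<in>_. ?f t = 0) \<longleftrightarrow> (\<forall>t\<in>_. ?f1 t = 0)")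
proof -
  have "\<forall>\<^sub>F t in at t1. \<forall>x\<in>F. w (z x) t = w1 (w (z x) t1) t"
    using local_sections_agree[OF g rw rw1 t1 z] F by (simp add: eventually_ball_finite_distrib)
  then have ev: "\<forall>\<^sub>F t in at t1. ?f t = ?f1 t"
    by eventually_elim simp
  have z1: "w (z x) t1 \<in> fib g t1" if "x \<in> F" for x
    using local_sections_bij[OF rw t1] z[OF that] by (rule bij_betw_apply)
  have hol: "?f holomorphic_on ball t0 r"
    by (intro e holomorphic_intros local_sections_holomorphic[OF rw] z)
  have hol1: "?f1 holomorphic_on ball t1 r1"
    by (intro e holomorphic_intros local_sections_holomorphic[OF rw1] z1)
  have in1: "t1 \<in> ball t1 r1"
    using local_sections_pos[OF rw1] by simp
  have e0: "\<forall>\<^sub>F t in at t1. t \<in> ball t0 r" "\<forall>\<^sub>F t in at t1. t \<in> ball t1 r1"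
    by (rule eventually_at_in_open'[OF open_ball]; fact)+
  show ?thesis
  proof (intro iffI ballI)
    fix t assume *: "\<forall>t\<in>ball t0 r. ?f t = 0" and t: "t \<in> ball t1 r1"
    have "\<forall>\<^sub>F t in at t1. ?f1 t = 0"
      using ev e0(1) by eventually_elim (use * in auto)
    then show "?f1 t = 0"
      using holomorphic_zero_if_eventually[OF hol1 _ _ in1 _ t] by simp
  next
    fix t assume *: "\<forall>t\<in>ball t1 r1. ?f1 t = 0" and t: "t \<in> ball t0 r"
    have "\<forall>\<^sub>F t in at t1. ?f t = 0"
      using ev e0(2) by eventually_elim (use * in auto)
    then show "?f t = 0"
      using holomorphic_zero_if_eventually[OF hol _ _ t1 _ t] by simp
  qed
qed

text \<open>Analytic continuation by connectedness of the parameter interval: the property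
  \<open>P s\<close>, vanishing near \<open>\<gamma> s\<close> along the branches through the points
  \<open>\<delta> x s\<close>, is locally constant in \<open>s\<close>. The conclusion is its value
  at the centre for \<open>s = 1\<close>.\<close>

lemma vanishing_along_path:
  assumes g: "belyi g" and \<gamma>: "path \<gamma>" "path_image \<gamma> \<subseteq> - {0, 1}" and F: "finite F"
    and \<delta>: "\<And>x. x \<in> F \<Longrightarrow> path (\<delta> x)" "\<And>x u. x \<in> F \<Longrightarrow> u \<in> {0..1} \<Longrightarrow> poly g (\<delta> x u) = \<gamma> u"
    and e: "\<And>u U. u holomorphic_on U \<Longrightarrow> (\<lambda>t. e (u t) t) holomorphic_on U"
    and rw0: "local_sections g (\<gamma> 0) r0 w0"
    and van0: "\<And>t. t \<in> ball (\<gamma> 0) r0 \<Longrightarrow> e (\<Sum>x\<in>F. a x * w0 (\<delta> x 0) t) t = (0::complex)"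
  shows "e (\<Sum>x\<in>F. a x * \<delta> x 1) (\<gamma> 1) = 0"
proof -
  define Van where "Van s r w \<longleftrightarrow> (\<forall>t\<in>ball (\<gamma> s) r. e (\<Sum>x\<in>F. a x * w (\<delta> x s) t) t = 0)" for s r w
  define P where "P s \<longleftrightarrow> (\<forall>r w. local_sections g (\<gamma> s) r w \<longrightarrow> Van s r w)" for s
  have \<gamma>01: "\<gamma> s \<notin> {0, 1}" if "s \<in> {0..1}" for s
    using that \<gamma>(2) unfolding path_image_def by blast
  have \<delta>fib: "\<delta> x s \<in> fib g (\<gamma> s)" if "x \<in> F" "s \<in> {0..1}" for x s
    using \<delta>(2)[OF that] by (simp add: fib_def)
  \<comment> \<open>Vanishing does not depend on the chosen disc and branches: this is
    \<open>vanishing_transfer\<close> for two discs with the same centre.\<close>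
  have same: "P s \<longleftrightarrow> Van s r w" if s: "s \<in> {0..1}" and rw: "local_sections g (\<gamma> s) r w" for s r w
  proof
    assume V: "Van s r w"
    show "P s"
      unfolding P_def
    proof (intro allI impI)
      fix r1 w1 assume rw1: "local_sections g (\<gamma> s) r1 w1"
      have "\<gamma> s \<in> ball (\<gamma> s) r"
        using local_sections_pos[OF rw] by simp
      moreover have "w (\<delta> x s) (\<gamma> s) = \<delta> x s" if "x \<in> F" for x
        using local_sections_centre[OF rw \<delta>fib[OF that s]] .
      ultimately show "Van s r1 w1"
        using vanishing_transfer[where e=e and a=a and z="\<lambda>x. \<delta> x s" and F=F, OF g rw rw1 _ \<delta>fib[OF _ s] F e] V
        by (simp add: Van_def)
    qed
  qed (use rw in \<open>auto simp: P_def\<close>)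
  have "P 1"
  proof (rule connected_induction_simple[of "{0..1::real}" 0 1 P])
    show "P 0"
      using same[OF _ rw0] van0 by (simp add: Van_def)
    fix s assume s: "s \<in> {0..1::real}"
    obtain r w where rw: "local_sections g (\<gamma> s) r w"
      using local_sections_exist[OF g \<gamma>01[OF s]] by blast
    have c\<gamma>: "continuous (at s within {0..1}) \<gamma>"
      using \<gamma>(1) s by (simp add: path_def continuous_on_eq_continuous_within)
    have "\<forall>\<^sub>F u in at s within {0..1}. \<delta> x u = w (\<delta> x s) (\<gamma> u)" if x: "x \<in> F" for x
      using \<delta>(1)[OF x] \<delta>(2)[OF x] s
      by (intro local_sections_lift[OF g rw \<delta>fib[OF x s] _ _ s c\<gamma>])
         (auto simp: path_def continuous_on_eq_continuous_within)
    then have "\<forall>\<^sub>F u in at s within {0..1}. \<forall>x\<in>F. \<delta> x u = w (\<delta> x s) (\<gamma> u)"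
      using F by (simp add: eventually_ball_finite_distrib)
    moreover have "\<forall>\<^sub>F u in at s within {0..1}. \<gamma> u \<in> ball (\<gamma> s) r"
      using c\<gamma> local_sections_pos[OF rw] unfolding continuous_within
      by (intro topological_tendstoD) auto
    ultimately have "\<forall>\<^sub>F u in at s within {0..1}. (\<forall>x\<in>F. \<delta> x u = w (\<delta> x s) (\<gamma> u)) \<and> \<gamma> u \<in> ball (\<gamma> s) r"
      by (rule eventually_conj)
    then obtain S where S: "open S" "s \<in> S"
        "\<And>u. u \<in> S \<Longrightarrow> u \<noteq> s \<Longrightarrow> u \<in> {0..1} \<Longrightarrow> (\<forall>x\<in>F. \<delta> x u = w (\<delta> x s) (\<gamma> u)) \<and> \<gamma> u \<in> ball (\<gamma> s) r"
      unfolding eventually_at_topological by blast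
    \<comment> \<open>The filter omits \<open>s\<close> itself, where the claim follows from the
      normalization of the branches at the centre.\<close>
    have S': "(\<forall>x\<in>F. \<delta> x u = w (\<delta> x s) (\<gamma> u)) \<and> \<gamma> u \<in> ball (\<gamma> s) r" if "u \<in> S" "u \<in> {0..1}" for u
      using S(3)[OF that(1) _ that(2)] local_sections_centre[OF rw \<delta>fib[OF _ s]] local_sections_pos[OF rw]
      by (cases "u = s") auto
    have iff: "P u \<longleftrightarrow> Van s r w" if u: "u \<in> S" "u \<in> {0..1}" for u
    proof -
      obtain r1 w1 where rw1: "local_sections g (\<gamma> u) r1 w1"
        using local_sections_exist[OF g \<gamma>01[OF u(2)]] by blast
      have "Van s r w \<longleftrightarrow> Van u r1 w1"
        using vanishing_transfer[where e=e and a=a and z="\<lambda>x. \<delta> x s" and F=F, OF g rw rw1 _ \<delta>fib[OF _ s] F e] S'[OF u]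
        by (simp add: Van_def)
      then show ?thesis using same[OF u(2) rw1] by simp
    qed
    show "\<exists>T. openin (top_of_set {0..1}) T \<and> s \<in> T \<and> (\<forall>x\<in>T. \<forall>y\<in>T. P x \<longrightarrow> P y)"
      using S s iff by (intro exI[of _ "{0..1} \<inter> S"]) (auto simp: openin_open_Int)
  qed auto
  obtain r w where rw: "local_sections g (\<gamma> 1) r w"
    using local_sections_exist[OF g \<gamma>01[of 1]] by auto
  have "\<gamma> 1 \<in> ball (\<gamma> 1) r"
    using local_sections_pos[OF rw] by simp
  then have "e (\<Sum>x\<in>F. a x * w (\<delta> x 1) (\<gamma> 1)) (\<gamma> 1) = 0"
    using \<open>P 1\<close> rw unfolding P_def Van_def by blast
  moreover have "w (\<delta> x 1) (\<gamma> 1) = \<delta> x 1" if "x \<in> F" for x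
    using local_sections_centre[OF rw \<delta>fib[OF that]] by simp
  ultimately show ?thesis by simp
qed

section \<open>Galois equivariance of the monodromy\<close>

text \<open>Lifts of \<open>\<gamma>\<close> avoid the preimages of \<open>0\<close> and
  \<open>1\<close> automatically. The restriction mediates between permutations, which fix all
  points off the fiber, and extensional maps, which are \<open>undefined\<close> there.\<close>

lemma fiber_Mon_iff:
  "\<pi> \<in> fiber_Mon h \<longleftrightarrow> \<pi> permutes fib h (1/2) \<and>
     restrict \<pi> (fib h (1/2)) \<in> path_transports h (1/2) (1/2)"
proof -
  have F: "{x \<in> - (poly h -` {0, 1}). poly h x = 1/2} = fib h (1/2)"
    by (auto simp: fib_def)
  have img: "(path_image \<delta> \<subseteq> - (poly h -` {0, 1}) \<and> (\<forall>t\<in>{0..1}. poly h (\<delta> t) = \<gamma> t) \<and> Q) \<longleftrightarrow>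
      (\<forall>t\<in>{0..1}. poly h (\<delta> t) = \<gamma> t) \<and> Q" if "path_image \<gamma> \<subseteq> - {0, 1}" for \<gamma> \<delta> Q
    using that unfolding path_image_def image_subset_iff by auto
  have bij: "bij_betw (restrict \<pi> (fib h (1/2))) (fib h (1/2)) (fib h (1/2))" if "\<pi> permutes fib h (1/2)"
    using permutes_imp_bij[OF that] by simp
  show ?thesis
    unfolding fiber_Mon_def monodromy_group_def F path_transports_def mem_Collect_eq
  proof (intro conj_cong refl)
    assume "\<pi> permutes fib h (1/2)"
    then show "(\<exists>\<gamma>. path \<gamma> \<and> path_image \<gamma> \<subseteq> - {0, 1} \<and> pathstart \<gamma> = 1/2 \<and> pathfinish \<gamma> = 1/2 \<and>
          (\<forall>x\<in>fib h (1/2). \<exists>\<delta>. path \<delta> \<and> path_image \<delta> \<subseteq> - (poly h -` {0, 1}) \<and>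
             (\<forall>t\<in>{0..1}. poly h (\<delta> t) = \<gamma> t) \<and> pathstart \<delta> = x \<and> pathfinish \<delta> = \<pi> x)) \<longleftrightarrow>
       (restrict \<pi> (fib h (1/2)) \<in> extensional (fib h (1/2)) \<and>
        bij_betw (restrict \<pi> (fib h (1/2))) (fib h (1/2)) (fib h (1/2)) \<and>
        (\<exists>\<gamma>. path \<gamma> \<and> path_image \<gamma> \<subseteq> - {0, 1} \<and> pathstart \<gamma> = 1/2 \<and> pathfinish \<gamma> = 1/2 \<and>
          (\<forall>z\<in>fib h (1/2). \<exists>\<delta>. path \<delta> \<and> (\<forall>u\<in>{0..1}. poly h (\<delta> u) = \<gamma> u) \<and>
             pathstart \<delta> = z \<and> pathfinish \<delta> = restrict \<pi> (fib h (1/2)) z)))"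
      using bij by (simp add: img cong: conj_cong)
  qed
qed

lemma identity_path_transport:
  assumes "belyi h" "t \<notin> {0, 1}"
  shows "restrict (\<lambda>x. x) (fib h t) \<in> path_transports h t t"
proof -
  obtain r w where rw: "local_sections h t r w"
    using local_sections_exist[OF assms] by blast
  have "t \<in> ball t r"
    using local_sections_pos[OF rw] by simp
  moreover have "restrict (\<lambda>z. w z t) (fib h t) = restrict (\<lambda>x. x) (fib h t)"
    using local_sections_centre[OF rw] by (intro restrict_ext) auto
  ultimately show ?thesis
    using path_transports_local[OF rw, of t] by simp
qed

text \<open>The rational numbers are not dense in the complex plane, but they accumulate at
  \<open>1/2\<close>, which is enough for the identity theorem.\<close>

lemma Rats_half_islimpt: "0 < r \<Longrightarrow> (1/2::complex) islimpt (\<rat> \<inter> ball (1/2) r)"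
proof -
  assume r: "0 < r"
  show ?thesis
    unfolding islimpt_approachable
  proof (intro allI impI)
    fix d :: real assume "0 < d"
    then obtain n where n: "inverse (real (Suc n)) < min d r"
      using reals_Archimedean[of "min d r"] r by auto
    define x :: complex where "x = 1/2 + inverse (of_nat (Suc n))"
    have "dist x (1/2) = inverse (real (Suc n))"
      unfolding x_def dist_norm by (simp add: norm_inverse del: of_nat_Suc)
    moreover have "x \<in> \<rat>" "x \<noteq> 1/2"
      unfolding x_def by (auto simp del: of_nat_Suc)
    ultimately show "\<exists>x'\<in>\<rat> \<inter> ball (1/2 :: complex) r. x' \<noteq> 1/2 \<and> dist x' (1/2) < d"
      using n by (intro bexI[of _ x]) (auto simp: dist_commute)
  qed
qed

text \<open>The candidate for \<open>\<pi>\<close> is the pull-back of \<open>\<pi>'\<close> through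
  \<open>\<sigma>\<close>. It is clearly a bijection of the fiber; that it is a path transport is
  detected by the vanishing of the conjugated resolvent \<open>e\<close>.\<close>

lemma monodromy_conjugate:
  assumes \<sigma>: "\<sigma> \<in> Gal_Qbar" and h: "belyi h" "\<And>i. coeff h i \<in> Qbar" and g: "belyi (map_poly \<sigma> h)"
    and \<pi>': "\<pi>' \<in> fiber_Mon (map_poly \<sigma> h)"
  obtains \<pi> where "\<pi> \<in> fiber_Mon h" "\<And>x. x \<in> fib h (1/2) \<Longrightarrow> \<pi>' (\<sigma> x) = \<sigma> (\<pi> x)"
proof -
  define G where "G = map_poly \<sigma> h"
  define F where "F = fib h (1/2)"
  define \<tau> where "\<tau> = inv_into Qbar \<sigma>"
  note g = g[folded G_def]
  have half: "(1/2::complex) \<in> \<rat>"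
    by simp
  have GQ: "coeff G i \<in> Qbar" for i
    unfolding G_def using Gal_coeff_map_poly[OF \<sigma> h(2)] .
  have finF: "finite F"
    unfolding F_def using fib_finite[OF h(1) half_notin] .
  have bij: "bij_betw \<sigma> (fib h q) (fib G q)" if "q \<in> \<rat>" for q
    unfolding G_def using Gal_fib[OF \<sigma> h g[unfolded G_def] that] .
  have hsub: "fib h q \<subseteq> Qbar" and gsub: "fib G q \<subseteq> Qbar" if "q \<in> \<rat>" for q
    using fib_Qbar[OF h] fib_Qbar[OF g GQ] Qbar_Rats[OF that] by auto
  have \<tau>\<sigma>: "\<tau> (\<sigma> x) = x" if "x \<in> Qbar" for x
    unfolding \<tau>_def using Gal_bij[OF \<sigma>] that by (simp add: bij_betw_def)
  have \<sigma>\<tau>: "\<sigma> (\<tau> x) = x" "\<tau> x \<in> Qbar" if "x \<in> Qbar" for x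
    unfolding \<tau>_def using Gal_bij[OF \<sigma>] that
    by (auto simp: bij_betw_def f_inv_into_f inv_into_into)
  have \<tau>bij: "bij_betw \<tau> (fib G q) (fib h q)" if "q \<in> \<rat>" for q
  proof (rule bij_betw_byWitness[of _ \<sigma>])
    show "\<sigma> ` fib h q \<subseteq> fib G q"
      using bij[OF that] by (simp add: bij_betw_def)
    show "\<tau> ` fib G q \<subseteq> fib h q"
      using bij_betw_imp_surj_on[OF bij[OF that], symmetric] hsub[OF that] \<tau>\<sigma> by auto
  qed (use gsub[OF that] hsub[OF that] \<tau>\<sigma> \<sigma>\<tau> in auto)
  have \<sigma>F: "\<sigma> x \<in> fib G (1/2)" if "x \<in> F" for x
    using bij[OF half] that by (auto simp: F_def dest: bij_betw_apply)
  \<comment> \<open>Rational coefficients are fixed by \<open>\<sigma>\<close>. Injectivity over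
    \<open>1/2\<close> lets a value of the form identify the bijection, both at the start and at the
    end of the loop.\<close>
  obtain a :: "complex \<Rightarrow> complex" where a: "\<And>x. a x \<in> \<rat>" "inj_on (linear_form h a) (bijections h (1/2))"
    using separating_coefficients[of F "bijections h (1/2)"] finF bijections_card(1)[OF h(1) half_notin]
    unfolding linear_form_def[abs_def] F_def by (auto simp: bijections_def)
  have aQ: "a x \<in> Qbar" for x
    using a(1) Qbar_Rats by blast
  define A where "A = path_transports h (1/2)"
  define B where "B t = bijections h t - A t" for t
  have A: "locally_constant h A"
    unfolding A_def by (rule locally_constant_path_transports)
  have B: "locally_constant h B"
    unfolding B_def[abs_def] using A locally_constant_bijections by (rule locally_constant_diff[rotated])
  obtain e where e: "\<And>u U. u holomorphic_on U \<Longrightarrow> (\<lambda>t. e (u t) t) holomorphic_on U"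
    "\<And>T t. T \<in> Qbar \<Longrightarrow> t \<in> \<rat> - {0, 1} \<Longrightarrow> e (\<sigma> T) t = 0 \<longleftrightarrow> (\<exists>\<phi>\<in>A t. T = linear_form h a \<phi>)"
    by (rule conjugate_resolvent[OF \<sigma> h A aQ]) (rule that)
  obtain e' where e': "\<And>u U. u holomorphic_on U \<Longrightarrow> (\<lambda>t. e' (u t) t) holomorphic_on U"
    "\<And>T t. T \<in> Qbar \<Longrightarrow> t \<in> \<rat> - {0, 1} \<Longrightarrow> e' (\<sigma> T) t = 0 \<longleftrightarrow> (\<exists>\<phi>\<in>B t. T = linear_form h a \<phi>)"
    by (rule conjugate_resolvent[OF \<sigma> h B aQ]) (rule that)
  \<comment> \<open>A bijection between fibers of \<open>G\<close> over rational points becomes one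
    between fibers of \<open>h\<close>, and \<open>\<sigma>\<close> maps its linear form to the
    corresponding sum for \<open>\<psi>\<close>. It is applied to the local branches, to the
    identity and to \<open>\<pi>'\<close>.\<close>
  define pull where "pull \<psi> = restrict (\<lambda>x. \<tau> (\<psi> (\<sigma> x))) F" for \<psi>
  have pull: "pull \<psi> \<in> bijections h q" "linear_form h a (pull \<psi>) \<in> Qbar"
      "\<sigma> (linear_form h a (pull \<psi>)) = (\<Sum>x\<in>F. a x * \<psi> (\<sigma> x))"
    if q: "q \<in> \<rat>" and \<psi>: "bij_betw \<psi> (fib G (1/2)) (fib G q)" for \<psi> q
  proof -
    have "bij_betw (\<tau> \<circ> (\<psi> \<circ> \<sigma>)) F (fib h q)"
      using bij[OF half] \<psi> \<tau>bij[OF q] unfolding F_def by (intro bij_betw_trans)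
    then show "pull \<psi> \<in> bijections h q"
      by (simp add: pull_def bijections_def F_def o_def)
    have \<psi>Q: "\<psi> (\<sigma> x) \<in> Qbar" if "x \<in> F" for x
      using bij_betw_apply[OF \<psi> \<sigma>F[OF that]] gsub[OF q] by blast
    have lf: "linear_form h a (pull \<psi>) = (\<Sum>x\<in>F. a x * \<tau> (\<psi> (\<sigma> x)))"
      by (simp add: linear_form_def pull_def F_def)
    show "linear_form h a (pull \<psi>) \<in> Qbar"
      unfolding lf using aQ \<sigma>\<tau>(2) \<psi>Q by (intro Qbar_sum Qbar_mult) auto
    show "\<sigma> (linear_form h a (pull \<psi>)) = (\<Sum>x\<in>F. a x * \<psi> (\<sigma> x))"
      unfolding lf using aQ a(1) \<sigma>\<tau> \<psi>Q
      by (simp add: Gal_sum[OF \<sigma>] Gal_mult[OF \<sigma>] Qbar_mult Gal_Rats[OF \<sigma>])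
  qed
  obtain r w where rw: "local_sections G (1/2) r w"
    using local_sections_exist[OF g half_notin] by blast
  define u where "u t = (\<Sum>x\<in>F. a x * w (\<sigma> x) t)" for t
  have u: "u holomorphic_on ball (1/2) r"
    unfolding u_def[abs_def] using local_sections_holomorphic[OF rw \<sigma>F] by (intro holomorphic_intros) auto
  have in0: "1/2 \<in> ball (1/2) r"
    using local_sections_pos[OF rw] by simp
  \<comment> \<open>At rational \<open>t\<close> the branches pull back to some bijection, which
    lies in \<open>A t\<close> or in its complement \<open>B t\<close>.\<close>
  have or: "e (u t) t = 0 \<or> e' (u t) t = 0" if t: "t \<in> \<rat> \<inter> ball (1/2) r" for t
  proof -
    have b: "bij_betw (\<lambda>z. w z t) (fib G (1/2)) (fib G t)"
      using local_sections_bij[OF rw] t by blast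
    note p = pull[OF _ b]
    have t': "t \<in> \<rat> - {0, 1}"
      using t local_sections_ball[OF rw] by blast
    have "pull (\<lambda>z. w z t) \<in> A t \<or> pull (\<lambda>z. w z t) \<in> B t"
      using p(1) t by (auto simp: B_def)
    then show ?thesis
      using e(2)[OF p(2) t'] e'(2)[OF p(2) t'] p(3) t by (auto simp: u_def)
  qed
  \<comment> \<open>At \<open>1/2\<close> the branches pull back to the identity, the transport
    along a constant path, which lies in \<open>A (1/2)\<close>. Since the form is injective there,
    no element of \<open>B (1/2)\<close> shares its value.\<close>
  have "e' (u (1/2)) (1/2) \<noteq> 0"
  proof
    assume *: "e' (u (1/2)) (1/2) = 0"
    have idG: "bij_betw (\<lambda>x. x) (fib G (1/2)) (fib G (1/2))"
      by (simp add: bij_betw_def)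
    note p = pull[OF half idG]
    have "u (1/2) = (\<Sum>x\<in>F. a x * \<sigma> x)"
      unfolding u_def using local_sections_centre[OF rw \<sigma>F] by simp
    then obtain \<phi> where \<phi>: "\<phi> \<in> B (1/2)" "linear_form h a (pull (\<lambda>x. x)) = linear_form h a \<phi>"
      using * e'(2)[OF p(2), of "1/2"] p(3) half_notin by auto
    then have "pull (\<lambda>x. x) = \<phi>"
      using a(2) p(1) by (auto simp: B_def inj_on_def)
    moreover have "pull (\<lambda>x. x) = restrict (\<lambda>x. x) F"
      unfolding pull_def using \<tau>\<sigma> hsub[OF half] by (intro restrict_ext) (auto simp: F_def)
    ultimately show False
      using \<phi>(1) identity_path_transport[OF h(1) half_notin] by (simp add: B_def A_def F_def)
  qed
  moreover have "isCont (\<lambda>t. e' (u t) t) (1/2)"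
    using holomorphic_on_imp_continuous_on[OF e'(1)[OF u]] in0
    by (simp add: continuous_on_eq_continuous_at)
  ultimately obtain d where d: "d > 0" "\<And>t. dist (1/2) t < d \<Longrightarrow> e' (u t) t \<noteq> 0"
    using continuous_at_avoid[of "1/2" "\<lambda>t. e' (u t) t" 0] by (auto simp: dist_commute)
  \<comment> \<open>By continuity the second factor stays nonzero near \<open>1/2\<close>, so the
    first one vanishes at the rational points there; the identity theorem extends this to the
    disc.\<close>
  have van: "e (u t) t = 0" if "t \<in> ball (1/2) r" for t
  proof (rule analytic_continuation[OF e(1)[OF u], of "\<rat> \<inter> ball (1/2) (min r d)" "1/2"])
    show "1/2 islimpt (\<rat> \<inter> ball (1/2::complex) (min r d))"
      using local_sections_pos[OF rw] d(1) by (intro Rats_half_islimpt) auto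
    show "e (u t) t = 0" if "t \<in> \<rat> \<inter> ball (1/2) (min r d)" for t
      using or[of t] d(2)[of t] that by auto
  qed (use that in0 in auto)
  have \<pi>'p: "\<pi>' permutes fib G (1/2)" "restrict \<pi>' (fib G (1/2)) \<in> path_transports G (1/2) (1/2)"
    using \<pi>' fiber_Mon_iff unfolding G_def by auto
  then obtain \<gamma> where \<gamma>: "path \<gamma>" "path_image \<gamma> \<subseteq> - {0, 1}" "pathstart \<gamma> = 1/2" "pathfinish \<gamma> = 1/2"
    "\<And>z. z \<in> fib G (1/2) \<Longrightarrow> \<exists>\<delta>. path \<delta> \<and> (\<forall>u\<in>{0..1}. poly G (\<delta> u) = \<gamma> u) \<and>
           pathstart \<delta> = z \<and> pathfinish \<delta> = restrict \<pi>' (fib G (1/2)) z"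
    unfolding path_transports_def by blast
  have "\<exists>\<delta>. \<forall>x\<in>F. path (\<delta> x) \<and> (\<forall>u\<in>{0..1}. poly G (\<delta> x u) = \<gamma> u) \<and>
           \<delta> x 0 = \<sigma> x \<and> \<delta> x 1 = \<pi>' (\<sigma> x)"
    using \<gamma>(5)[OF \<sigma>F] \<sigma>F by (intro bchoice ballI) (fastforce simp: pathstart_def pathfinish_def)
  then obtain \<delta> where \<delta>: "\<And>x. x \<in> F \<Longrightarrow> path (\<delta> x)"
      "\<And>x u. x \<in> F \<Longrightarrow> u \<in> {0..1} \<Longrightarrow> poly G (\<delta> x u) = \<gamma> u"
      "\<And>x. x \<in> F \<Longrightarrow> \<delta> x 0 = \<sigma> x" "\<And>x. x \<in> F \<Longrightarrow> \<delta> x 1 = \<pi>' (\<sigma> x)"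
    by blast
  have \<gamma>01: "\<gamma> 0 = 1/2" "\<gamma> 1 = 1/2"
    using \<gamma> by (auto simp: pathstart_def pathfinish_def)
  have "e (\<Sum>x\<in>F. a x * \<delta> x 1) (\<gamma> 1) = 0"
  proof (rule vanishing_along_path[OF g \<gamma>(1,2) finF \<delta>(1,2) e(1)])
    show "local_sections G (\<gamma> 0) r w" using rw unfolding \<gamma>01 .
    show "e (\<Sum>x\<in>F. a x * w (\<delta> x 0) t) t = 0" if "t \<in> ball (\<gamma> 0) r" for t
      using van[of t] that \<delta>(3) unfolding \<gamma>01 by (simp add: u_def)
  qed
  then have end0: "e (\<Sum>x\<in>F. a x * \<pi>' (\<sigma> x)) (1/2) = 0"
    using \<delta>(4) unfolding \<gamma>01 by simp
  \<comment> \<open>The vanishing at the end of the loop is read back through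
    \<open>\<sigma>\<close>: the form takes the same value on \<open>pull \<pi>'\<close> as on an
    element of \<open>A (1/2)\<close>, and by injectivity the two coincide.\<close>
  note p = pull[OF half permutes_imp_bij[OF \<pi>'p(1)]]
  obtain \<phi> where \<phi>: "\<phi> \<in> A (1/2)" "linear_form h a (pull \<pi>') = linear_form h a \<phi>"
    using end0 e(2)[OF p(2), of "1/2"] p(3) half_notin by auto
  moreover have "\<phi> \<in> bijections h (1/2)"
    using \<phi>(1) A by (auto simp: locally_constant_def)
  ultimately have pA: "pull \<pi>' \<in> path_transports h (1/2) (1/2)"
    using a(2) p(1) by (auto simp: A_def inj_on_def)
  define \<pi> where "\<pi> x = (if x \<in> F then pull \<pi>' x else x)" for x
  have "restrict \<pi> F = pull \<pi>'"
    by (auto simp: \<pi>_def pull_def)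
  moreover have "\<pi> permutes F"
  proof (rule bij_imp_permutes)
    have "bij_betw (pull \<pi>') F F"
      using p(1) by (simp add: bijections_def F_def)
    then show "bij_betw \<pi> F F"
      by (rule bij_betw_cong[THEN iffD1, rotated]) (simp add: \<pi>_def)
  qed (simp add: \<pi>_def)
  ultimately have "\<pi> \<in> fiber_Mon h"
    using pA by (simp add: fiber_Mon_iff F_def)
  moreover have "\<pi>' (\<sigma> x) = \<sigma> (\<pi> x)" if "x \<in> F" for x
  proof -
    have "\<pi>' (\<sigma> x) \<in> fib G (1/2)"
      using permutes_in_image[OF \<pi>'p(1)] \<sigma>F[OF that] by simp
    then show ?thesis
      using that \<sigma>\<tau>(1) gsub[OF half] by (auto simp: \<pi>_def pull_def)
  qed
  ultimately show ?thesis
    using that by (simp add: F_def)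
qed

section \<open>Edges and fibers\<close>

text \<open>An edge contains a point over \<open>c\<close> because the segment lifts through each of
  its points, and only one because lifts are unique.\<close>

lemma edges_fib:
  assumes h: "belyi h" and c: "c \<in> open_segment 0 1"
  obtains \<beta> where "bij_betw \<beta> (fib h c) (edges h)"
    "\<And>x y. x \<in> fib h c \<Longrightarrow> y \<in> fib h c \<Longrightarrow> y \<in> \<beta> x \<longleftrightarrow> y = x"
proof -
  define I where "I = open_segment (0::complex) 1"
  define W where "W = poly h -` I"
  define C where "C = - (poly h -` {0, 1})"
  note cov = belyi_covering_space[OF h, folded C_def]
  have I: "I \<subseteq> - {0, 1}" "convex I" "c \<in> I"
    using c by (auto simp: I_def open_segment_def[of 0 1] intro: convex_open_segment[unfolded open_segment_def])
  have WC: "W \<subseteq> C"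
    using I(1) by (auto simp: W_def C_def)
  \<comment> \<open>The segment is convex, hence simply connected and locally path connected, so its
    inclusion into \<open>- {0, 1}\<close> lifts through any prescribed point.\<close>
  have lift: "\<exists>g. continuous_on I g \<and> g \<in> I \<rightarrow> C \<and> g s = u \<and> (\<forall>t\<in>I. poly h (g t) = t)"
    if s: "s \<in> I" and u: "poly h u = s" for s u
  proof -
    have "u \<in> C"
      using s u I(1) by (auto simp: C_def)
    then obtain g where "continuous_on I g" "g \<in> I \<rightarrow> C" "g s = u" "\<And>t. t \<in> I \<Longrightarrow> poly h (g t) = t"
      using covering_space_lift_strong[OF cov _ s convex_imp_simply_connected[OF I(2)]
          convex_imp_locally_path_connected[OF I(2)] continuous_on_id, of u] I(1) u by auto
    then show ?thesis by blast
  qed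
  \<comment> \<open>On a component of \<open>W\<close>, both the identity and \<open>g \<circ> h\<close>, for a section \<open>g\<close> through \<open>x\<close>, lift \<open>h\<close>.\<close>
  have uniq: "y = x"
    if x: "x \<in> fib h c" and y: "y \<in> fib h c" and xy: "y \<in> connected_component_set W x" for x y
  proof -
    obtain g where g: "continuous_on I g" "g \<in> I \<rightarrow> C" "g c = x" "\<And>t. t \<in> I \<Longrightarrow> poly h (g t) = t"
      using lift[OF I(3), of x] x by (auto simp: fib_def)
    define T where "T = connected_component_set W x"
    have TW: "T \<subseteq> W"
      unfolding T_def by (rule connected_component_subset)
    have "x \<in> W"
      using x I(3) by (simp add: W_def fib_def)
    have "y = g (poly h y)"
    proof (rule covering_space_lift_unique[OF cov, of "\<lambda>u. u" x "\<lambda>u. g (poly h u)" T "poly h" y])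
      show "x = g (poly h x)"
        using x g(3) by (simp add: fib_def)
      show "continuous_on T (\<lambda>u. g (poly h u))"
        using TW by (intro continuous_on_compose2[OF g(1)] continuous_intros) (auto simp: W_def)
      show "connected T"
        by (simp add: T_def)
      show "x \<in> T"
        using \<open>x \<in> W\<close> by (simp add: T_def)
      show "y \<in> T"
        using xy by (simp add: T_def)
    qed (use TW WC g I(1) in \<open>auto simp: W_def intro!: continuous_intros\<close>)
    then show ?thesis
      using y g(3) by (simp add: fib_def)
  qed
  have ex: "\<exists>x\<in>fib h c. connected_component_set W u = connected_component_set W x" if "u \<in> W" for u
  proof -
    obtain g where g: "continuous_on I g" "g (poly h u) = u" "\<And>t. t \<in> I \<Longrightarrow> poly h (g t) = t"
      using lift[of "poly h u" u] \<open>u \<in> W\<close> by (auto simp: W_def)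
    have "connected (g ` I)"
      using g(1) I(2) by (intro connected_continuous_image convex_connected)
    moreover have "g ` I \<subseteq> W"
      using g(3) by (auto simp: W_def)
    moreover have "u \<in> g ` I" "g c \<in> g ` I"
      using image_eqI[of u g "poly h u" I, OF g(2)[symmetric]] \<open>u \<in> W\<close> I(3) by (simp_all add: W_def)
    ultimately have "connected_component W u (g c)"
      unfolding connected_component_def by blast
    then have "connected_component_set W u = connected_component_set W (g c)"
      by (rule connected_component_eq[symmetric, OF CollectI])
    then show ?thesis
      using g(3)[OF I(3)] by (intro bexI[of _ "g c"]) (simp_all add: fib_def)
  qed
  define \<beta> where "\<beta> x = connected_component_set W x" for x
  have fibW: "x \<in> W" if "x \<in> fib h c" for x
    using that I(3) by (simp add: W_def fib_def)
  have self: "x \<in> \<beta> x" if "x \<in> fib h c" for x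
    using fibW[OF that] by (simp add: \<beta>_def)
  show ?thesis
  proof (rule that[of \<beta>])
    show "y \<in> \<beta> x \<longleftrightarrow> y = x" if "x \<in> fib h c" "y \<in> fib h c" for x y
      using uniq[OF that] self[OF that(1)] by (auto simp: \<beta>_def)
    show "bij_betw \<beta> (fib h c) (edges h)"
    proof (rule bij_betw_imageI)
      show "inj_on \<beta> (fib h c)"
        using uniq self by (intro inj_onI) (metis \<beta>_def)
      show "\<beta> ` fib h c = edges h"
      proof -
        have "edges h = \<beta> ` W"
          by (simp add: edges_def components_def W_def I_def \<beta>_def[abs_def])
        moreover have "\<beta> ` W \<subseteq> \<beta> ` fib h c"
          using ex unfolding \<beta>_def by blast
        moreover have "\<beta> ` fib h c \<subseteq> \<beta> ` W"
          using fibW by (intro image_mono subsetI)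
        ultimately show ?thesis by simp
      qed
    qed
  qed
qed

lemma half_open_segment: "(1/2 :: complex) \<in> open_segment 0 1"
proof -
  have "midpoint (0::complex) 1 = 1/2"
    by (simp add: midpoint_def scaleR_conv_of_real)
  then show ?thesis
    by (metis midpoint_in_open_segment zero_neq_one)
qed

section \<open>Conjugation of permutations, and passage from fibers to edges\<close>

lemma conj_perm_compose:
  assumes "bij_betw \<tau> A B" "bij_betw \<tau>' B C" "\<pi> permutes A"
  shows "conj_perm A C (\<tau>' \<circ> \<tau>) \<pi> = conj_perm B C \<tau>' (conj_perm A B \<tau> \<pi>)"
proof
  fix y
  show "conj_perm A C (\<tau>' \<circ> \<tau>) \<pi> y = conj_perm B C \<tau>' (conj_perm A B \<tau> \<pi>) y"
  proof (cases "y \<in> C")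
    case True
    then obtain x where x: "x \<in> A" "y = \<tau>' (\<tau> x)"
      using assms(1,2) by (auto simp: bij_betw_def)
    have "inv_into A (\<tau>' \<circ> \<tau>) y = x"
      using bij_betw_inv_into_left[OF bij_betw_trans[OF assms(1,2)] x(1)] x by simp
    moreover have "inv_into B \<tau>' y = \<tau> x" "inv_into A \<tau> (\<tau> x) = x"
      using assms(1,2) x by (auto simp: bij_betw_inv_into_left bij_betw_apply)
    ultimately show ?thesis
      using True x assms(1) by (simp add: conj_perm_def bij_betw_apply)
  qed (simp add: conj_perm_def)
qed

lemma conj_perm_cong:
  assumes "\<pi> permutes A" "\<And>x. x \<in> A \<Longrightarrow> \<tau> x = \<tau>' x" "bij_betw \<tau> A B"
  shows "conj_perm A B \<tau> \<pi> = conj_perm A B \<tau>' \<pi>"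
proof
  fix y
  have "\<tau> (\<pi> (inv_into A \<tau> y)) = \<tau>' (\<pi> (inv_into A \<tau>' y))" if yB: "y \<in> B"
  proof -
    obtain x where x: "x \<in> A" "y = \<tau> x"
      using yB bij_betw_imp_surj_on[OF assms(3)] by blast
    moreover have "bij_betw \<tau>' A B"
      using assms(2,3) bij_betw_cong by blast
    ultimately have "inv_into A \<tau> y = x" "inv_into A \<tau>' y = x"
      using assms(2,3) by (auto simp: bij_betw_inv_into_left) (metis bij_betw_inv_into_left)
    then show ?thesis
      using assms(2) permutes_in_image[OF assms(1)] x(1) by simp
  qed
  then show "conj_perm A B \<tau> \<pi> y = conj_perm A B \<tau>' \<pi> y"
    by (simp add: conj_perm_def)
qed

lemma conj_perm_permutes:
  assumes "bij_betw \<tau> A B" "\<pi> permutes A"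
  shows "conj_perm A B \<tau> \<pi> permutes B"
proof (rule bij_imp_permutes)
  have "bij_betw (\<tau> \<circ> (\<pi> \<circ> inv_into A \<tau>)) B B"
    using bij_betw_inv_into[OF assms(1)] permutes_imp_bij[OF assms(2)] assms(1)
    by (intro bij_betw_trans)
  then show "bij_betw (conj_perm A B \<tau> \<pi>) B B"
    by (rule bij_betw_cong[THEN iffD1, rotated]) (simp add: conj_perm_def)
qed (simp add: conj_perm_def)

text \<open>Every point of \<open>B\<close> has the form \<open>\<tau> x\<close>, and off
  \<open>B\<close> both sides are the identity, so the intertwining relation on \<open>A\<close>
  suffices.\<close>

lemma conj_perm_eqI:
  assumes "bij_betw \<tau> A B" "\<rho> permutes B" "\<And>x. x \<in> A \<Longrightarrow> \<rho> (\<tau> x) = \<tau> (\<pi> x)"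
  shows "conj_perm A B \<tau> \<pi> = \<rho>"
proof
  fix y
  show "conj_perm A B \<tau> \<pi> y = \<rho> y"
  proof (cases "y \<in> B")
    case True
    then have "inv_into A \<tau> y \<in> A" "\<tau> (inv_into A \<tau> y) = y"
      using assms(1) by (auto simp: bij_betw_def inv_into_into f_inv_into_f)
    then show ?thesis
      using True assms(3)[of "inv_into A \<tau> y"] by (simp add: conj_perm_def)
  next
    case False
    then show ?thesis
      using assms(2) by (simp add: conj_perm_def permutes_not_in)
  qed
qed

text \<open>An edge contains no point of the fiber but its own, so the membership
  \<open>\<pi> x \<in> \<rho> e\<close> in \<open>Mon\<close> says exactly that
  \<open>\<beta>\<close> intertwines \<open>\<pi>\<close> and \<open>\<rho>\<close>.\<close>

lemma Mon_conj_fiber_Mon: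
  assumes \<beta>: "bij_betw \<beta> (fib h (1/2)) (edges h)"
    and \<beta>_iff: "\<And>x y. x \<in> fib h (1/2) \<Longrightarrow> y \<in> fib h (1/2) \<Longrightarrow> y \<in> \<beta> x \<longleftrightarrow> y = x"
  shows "Mon h = conj_perm (fib h (1/2)) (edges h) \<beta> ` fiber_Mon h"
proof (intro equalityI subsetI)
  fix \<rho> assume "\<rho> \<in> Mon h"
  then obtain \<pi> where \<rho>: "\<rho> permutes edges h" and \<pi>: "\<pi> \<in> fiber_Mon h"
    and r: "\<And>e x. e \<in> edges h \<Longrightarrow> x \<in> e \<Longrightarrow> poly h x = 1/2 \<Longrightarrow> \<pi> x \<in> \<rho> e"
    by (auto simp: Mon_def)
  have "\<pi> permutes fib h (1/2)"
    using \<pi> fiber_Mon_iff by blast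
  have "\<rho> (\<beta> x) = \<beta> (\<pi> x)" if x: "x \<in> fib h (1/2)" for x
  proof -
    have "\<beta> x \<in> edges h"
      using \<beta> x by (rule bij_betw_apply)
    then have *: "\<pi> x \<in> \<rho> (\<beta> x)" "\<rho> (\<beta> x) \<in> edges h"
      using r x \<beta>_iff[OF x x] permutes_in_image[OF \<rho>] by (auto simp: fib_def)
    then obtain y where y: "y \<in> fib h (1/2)" "\<rho> (\<beta> x) = \<beta> y"
      using \<beta> by (auto simp: bij_betw_def)
    then show ?thesis
      using * \<beta>_iff[OF y(1), of "\<pi> x"] permutes_in_image[OF \<open>\<pi> permutes fib h (1/2)\<close>] x by simp
  qed
  then have "conj_perm (fib h (1/2)) (edges h) \<beta> \<pi> = \<rho>"
    by (rule conj_perm_eqI[OF \<beta> \<rho>])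
  then show "\<rho> \<in> conj_perm (fib h (1/2)) (edges h) \<beta> ` fiber_Mon h"
    using \<pi> by blast
next
  fix \<rho> assume "\<rho> \<in> conj_perm (fib h (1/2)) (edges h) \<beta> ` fiber_Mon h"
  then obtain \<pi> where \<pi>: "\<pi> \<in> fiber_Mon h" and \<rho>: "\<rho> = conj_perm (fib h (1/2)) (edges h) \<beta> \<pi>"
    by blast
  have p: "\<pi> permutes fib h (1/2)"
    using \<pi> fiber_Mon_iff by blast
  have "\<pi> x \<in> \<rho> e" if e: "e \<in> edges h" and xe: "x \<in> e" "poly h x = 1/2" for e x
  proof -
    obtain y where y: "y \<in> fib h (1/2)" "e = \<beta> y"
      using bij_betw_imp_surj_on[OF \<beta>] e by blast
    have x: "x \<in> fib h (1/2)"
      using xe by (simp add: fib_def)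
    then have "x = y"
      using \<beta>_iff[OF y(1) x] xe y by simp
    then have "inv_into (fib h (1/2)) \<beta> e = x"
      using y bij_betw_inv_into_left[OF \<beta>] by simp
    then show ?thesis
      using \<beta>_iff permutes_in_image[OF p] x e by (simp add: \<rho> conj_perm_def)
  qed
  then show "\<rho> \<in> Mon h"
    using conj_perm_permutes[OF \<beta> p] \<pi> by (auto simp: Mon_def \<rho>)
qed

lemma Gal_inverse:
  assumes \<sigma>: "\<sigma> \<in> Gal_Qbar"
  shows "inv_into Qbar \<sigma> \<in> Gal_Qbar"
proof -
  let ?\<tau> = "inv_into Qbar \<sigma>"
  note b = Gal_bij[OF \<sigma>]
  have in_Q: "?\<tau> x \<in> Qbar" and r: "\<sigma> (?\<tau> x) = x" if "x \<in> Qbar" for x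
    using that b by (auto simp: bij_betw_def inv_into_into f_inv_into_f)
  have l: "?\<tau> (\<sigma> x) = x" if "x \<in> Qbar" for x
    using that b by (simp add: bij_betw_def)
  have "?\<tau> (x + y) = ?\<tau> x + ?\<tau> y" "?\<tau> (x * y) = ?\<tau> x * ?\<tau> y" if "x \<in> Qbar" "y \<in> Qbar" for x y
    using l[of "?\<tau> x + ?\<tau> y"] l[of "?\<tau> x * ?\<tau> y"] that in_Q r
    by (simp_all add: Gal_add[OF \<sigma>] Gal_mult[OF \<sigma>] Qbar_add Qbar_mult)
  moreover have "?\<tau> q = q" if "q \<in> \<rat>" for q
    using l[of q] Gal_Rats[OF \<sigma> that] Qbar_Rats[OF that] by simp
  ultimately show ?thesis
    using bij_betw_inv_into[OF b] by (simp add: Gal_Qbar_def)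
qed

text \<open>One inclusion is \<open>monodromy_conjugate\<close>. The other is the same lemma for the
  inverse automorphism, which carries the conjugate polynomial back to \<open>h\<close>.\<close>

lemma fiber_Mon_conjugate:
  assumes \<sigma>: "\<sigma> \<in> Gal_Qbar" and h: "belyi h" "\<And>i. coeff h i \<in> Qbar" and g: "belyi (map_poly \<sigma> h)"
  shows "fiber_Mon (map_poly \<sigma> h) =
    conj_perm (fib h (1/2)) (fib (map_poly \<sigma> h) (1/2)) \<sigma> ` fiber_Mon h"
proof -
  define G where "G = map_poly \<sigma> h"
  define \<tau> where "\<tau> = inv_into Qbar \<sigma>"
  note g = g[folded G_def]
  have bij: "bij_betw \<sigma> (fib h (1/2)) (fib G (1/2))"
    unfolding G_def using Gal_fib[OF \<sigma> h g[unfolded G_def]] by simp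
  have \<tau>: "\<tau> \<in> Gal_Qbar"
    unfolding \<tau>_def by (rule Gal_inverse[OF \<sigma>])
  have \<tau>\<sigma>: "\<tau> (\<sigma> x) = x" and \<sigma>\<tau>: "\<sigma> (\<tau> x) = x" if "x \<in> Qbar" for x
    using Gal_bij[OF \<sigma>] that by (auto simp: \<tau>_def bij_betw_def f_inv_into_f)
  have GQ: "coeff G i \<in> Qbar" for i
    unfolding G_def using Gal_coeff_map_poly[OF \<sigma> h(2)] .
  have sub: "fib h (1/2) \<subseteq> Qbar" "fib G (1/2) \<subseteq> Qbar"
    using fib_Qbar[OF h] fib_Qbar[OF g GQ] Qbar_Rats[of "1/2"] by auto
  have hG: "map_poly \<tau> G = h"
    unfolding G_def by (rule poly_eqI) (simp add: coeff_map_poly Gal_0[OF \<sigma>] Gal_0[OF \<tau>] \<tau>\<sigma> h(2))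
  have "fiber_Mon G = conj_perm (fib h (1/2)) (fib G (1/2)) \<sigma> ` fiber_Mon h"
  proof (intro equalityI subsetI)
    fix \<pi>' assume \<pi>': "\<pi>' \<in> fiber_Mon G"
    obtain \<pi> where \<pi>: "\<pi> \<in> fiber_Mon h" "\<And>x. x \<in> fib h (1/2) \<Longrightarrow> \<pi>' (\<sigma> x) = \<sigma> (\<pi> x)"
      by (rule monodromy_conjugate[OF \<sigma> h g[unfolded G_def] \<pi>'[unfolded G_def]]) (rule that)
    have "conj_perm (fib h (1/2)) (fib G (1/2)) \<sigma> \<pi> = \<pi>'"
      using \<pi>' \<pi>(2) by (intro conj_perm_eqI[OF bij]) (auto simp: fiber_Mon_iff)
    then show "\<pi>' \<in> conj_perm (fib h (1/2)) (fib G (1/2)) \<sigma> ` fiber_Mon h"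
      using \<pi>(1) by blast
  next
    fix \<pi>' assume "\<pi>' \<in> conj_perm (fib h (1/2)) (fib G (1/2)) \<sigma> ` fiber_Mon h"
    then obtain \<pi> where \<pi>: "\<pi> \<in> fiber_Mon h" "\<pi>' = conj_perm (fib h (1/2)) (fib G (1/2)) \<sigma> \<pi>"
      by blast
    have gh: "belyi (map_poly \<tau> G)" "\<pi> \<in> fiber_Mon (map_poly \<tau> G)"
      using h(1) \<pi>(1) by (simp_all add: hG)
    obtain \<rho> where \<rho>: "\<rho> \<in> fiber_Mon G" "\<And>y. y \<in> fib G (1/2) \<Longrightarrow> \<pi> (\<tau> y) = \<tau> (\<rho> y)"
      by (rule monodromy_conjugate[OF \<tau> g GQ gh]) (rule that)
    have p: "\<rho> permutes fib G (1/2)"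
      using \<rho>(1) fiber_Mon_iff by blast
    have "conj_perm (fib h (1/2)) (fib G (1/2)) \<sigma> \<pi> = \<rho>"
    proof (rule conj_perm_eqI[OF bij p])
      fix x assume x: "x \<in> fib h (1/2)"
      have y: "\<sigma> x \<in> fib G (1/2)"
        using bij x by (rule bij_betw_apply)
      then have "\<rho> (\<sigma> x) \<in> Qbar"
        using sub permutes_in_image[OF p] by blast
      then have "\<sigma> (\<tau> (\<rho> (\<sigma> x))) = \<rho> (\<sigma> x)"
        by (rule \<sigma>\<tau>)
      moreover have "\<tau> (\<sigma> x) = x"
        using x sub \<tau>\<sigma> by blast
      ultimately show "\<rho> (\<sigma> x) = \<sigma> (\<pi> x)"
        using \<rho>(2)[OF y] by simp
    qed
    then show "\<pi>' \<in> fiber_Mon G"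
      using \<rho>(1) \<pi>(2) by simp
  qed
  then show ?thesis
    by (simp add: G_def)
qed

lemma Mon_conjugate:
  assumes \<sigma>: "\<sigma> \<in> Gal_Qbar" and h: "belyi h" "\<And>i. coeff h i \<in> Qbar" and g: "belyi (map_poly \<sigma> h)"
  shows "perm_isomorphic (edges h) (Mon h) (edges (map_poly \<sigma> h)) (Mon (map_poly \<sigma> h))"
proof -
  define G where "G = map_poly \<sigma> h"
  define F where "F = fib h (1/2)"
  define F' where "F' = fib G (1/2)"
  note g = g[folded G_def]
  obtain \<beta> where \<beta>: "bij_betw \<beta> F (edges h)" "\<And>x y. x \<in> F \<Longrightarrow> y \<in> F \<Longrightarrow> y \<in> \<beta> x \<longleftrightarrow> y = x"
    by (rule edges_fib[OF h(1) half_open_segment, folded F_def]) (rule that)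
  obtain \<beta>' where \<beta>': "bij_betw \<beta>' F' (edges G)" "\<And>x y. x \<in> F' \<Longrightarrow> y \<in> F' \<Longrightarrow> y \<in> \<beta>' x \<longleftrightarrow> y = x"
    by (rule edges_fib[OF g half_open_segment, folded F'_def]) (rule that)
  have bij: "bij_betw \<sigma> F F'"
    unfolding F_def F'_def G_def using Gal_fib[OF \<sigma> h g[unfolded G_def]] by simp
  \<comment> \<open>An edge is replaced by its point over \<open>1/2\<close>,
    \<open>\<sigma>\<close> is applied, and the edge through the image is taken.\<close>
  define T where "T = (\<beta>' \<circ> \<sigma>) \<circ> inv_into F \<beta>"
  have \<beta>'\<sigma>: "bij_betw (\<beta>' \<circ> \<sigma>) F (edges G)"
    using bij \<beta>'(1) by (rule bij_betw_trans)
  have T: "bij_betw T (edges h) (edges G)"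
    unfolding T_def using bij_betw_inv_into[OF \<beta>(1)] \<beta>'\<sigma> by (rule bij_betw_trans)
  have conj: "conj_perm F' (edges G) \<beta>' (conj_perm F F' \<sigma> \<pi>) =
      conj_perm (edges h) (edges G) T (conj_perm F (edges h) \<beta> \<pi>)" if "\<pi> \<in> fiber_Mon h" for \<pi>
  proof -
    have p: "\<pi> permutes F"
      using that fiber_Mon_iff unfolding F_def by blast
    have "conj_perm F (edges G) (\<beta>' \<circ> \<sigma>) \<pi> = conj_perm F (edges G) (T \<circ> \<beta>) \<pi>"
      using bij_betw_inv_into_left[OF \<beta>(1)] by (intro conj_perm_cong[OF p _ \<beta>'\<sigma>]) (simp add: T_def)
    then show ?thesis
      using conj_perm_compose[OF bij \<beta>'(1) p] conj_perm_compose[OF \<beta>(1) T p] by simp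
  qed
  have "Mon G = conj_perm F' (edges G) \<beta>' ` conj_perm F F' \<sigma> ` fiber_Mon h"
    using Mon_conj_fiber_Mon[OF \<beta>'[unfolded F'_def]] fiber_Mon_conjugate[OF \<sigma> h g[unfolded G_def]]
    by (simp add: F_def F'_def G_def)
  also have "\<dots> = conj_perm (edges h) (edges G) T ` conj_perm F (edges h) \<beta> ` fiber_Mon h"
    using conj by (simp add: image_image cong: image_cong)
  also have "conj_perm F (edges h) \<beta> ` fiber_Mon h = Mon h"
    using Mon_conj_fiber_Mon[OF \<beta>[unfolded F_def]] by (simp add: F_def)
  finally show ?thesis
    using T unfolding perm_isomorphic_def G_def by blast
qed

section \<open>Iterates\<close>

lemma poly_iter_simps:
  "poly_iter 0 f = [:0, 1:]" "poly_iter (Suc n) f = pcompose f (poly_iter n f)"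
  by (simp_all add: poly_iter_def)

lemma Qbar_coeff_pcompose:
  assumes "\<And>i. coeff p i \<in> Qbar" "\<And>i. coeff q i \<in> Qbar"
  shows "coeff (pcompose p q) i \<in> Qbar"
  using assms(1)
proof (induction p arbitrary: i)
  case (pCons a p)
  have "coeff p i \<in> Qbar" for i
    using pCons.prems[of "Suc i"] by simp
  then have "coeff (pcompose p q) i \<in> Qbar" for i
    by (rule pCons.IH)
  moreover have "coeff [:a:] i \<in> Qbar"
    using pCons.prems[of 0] by (auto simp: coeff_pCons Qbar_Rats split: nat.splits)
  ultimately show ?case
    using assms(2) by (simp add: pcompose_pCons Qbar_add Qbar_coeff_mult)
qed (simp add: Qbar_Rats)

text \<open>Both sides agree at each of the infinitely many rational points, where
  \<open>Gal_poly\<close> evaluates them.\<close>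

lemma map_poly_pcompose_Gal:
  assumes \<sigma>: "\<sigma> \<in> Gal_Qbar" and p: "\<And>i. coeff p i \<in> Qbar" and q: "\<And>i. coeff q i \<in> Qbar"
  shows "map_poly \<sigma> (pcompose p q) = pcompose (map_poly \<sigma> p) (map_poly \<sigma> q)" (is "?l = ?r")
proof (rule ccontr)
  assume "?l \<noteq> ?r"
  then have "finite {x. poly (?l - ?r) x = 0}"
    by (intro poly_roots_finite) simp
  moreover have "x \<in> {x. poly (?l - ?r) x = 0}" if x: "x \<in> \<rat>" for x
  proof -
    have xQ: "x \<in> Qbar"
      using x by (rule Qbar_Rats)
    have "poly ?l x = \<sigma> (poly p (poly q x))"
      using Gal_poly[OF \<sigma> xQ Qbar_coeff_pcompose[OF p q]] Gal_Rats[OF \<sigma> x] by (simp add: poly_pcompose)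
    also have "\<dots> = poly (map_poly \<sigma> p) (poly (map_poly \<sigma> q) x)"
      using Gal_poly[OF \<sigma> Qbar_poly[OF q xQ] p] Gal_poly[OF \<sigma> xQ q] Gal_Rats[OF \<sigma> x] by simp
    finally show ?thesis by (simp add: poly_pcompose)
  qed
  then have "\<rat> \<subseteq> {x. poly (?l - ?r) x = 0}"
    by blast
  ultimately have "finite (\<rat> :: complex set)"
    by (rule rev_finite_subset)
  then show False
    using infinite_Rats_minus[of "{}"] by simp
qed

lemma poly_iter_Gal:
  assumes \<sigma>: "\<sigma> \<in> Gal_Qbar" and f: "\<And>i. coeff f i \<in> Qbar"
  shows "coeff (poly_iter n f) i \<in> Qbar" "poly_iter n (map_poly \<sigma> f) = map_poly \<sigma> (poly_iter n f)"
proof -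
  have *: "coeff (poly_iter n f) i \<in> Qbar" for n i
    by (induction n arbitrary: i)
      (auto simp: poly_iter_simps coeff_pCons Qbar_Rats intro!: Qbar_coeff_pcompose f split: nat.splits)
  then show "coeff (poly_iter n f) i \<in> Qbar" .
  show "poly_iter n (map_poly \<sigma> f) = map_poly \<sigma> (poly_iter n f)"
    by (induction n)
      (simp_all add: poly_iter_simps map_poly_pCons Gal_Rats[OF \<sigma>] map_poly_pcompose_Gal[OF \<sigma> f *])
qed

text \<open>By the chain rule, a critical point of the next iterate either is mapped by the previous
  one to a critical point of \<open>f\<close> or is critical for the previous one. In the second
  case its value stays in \<open>{0, 1}\<close> because \<open>f\<close> maps \<open>0\<close> and
  \<open>1\<close> to \<open>0\<close>.\<close>

lemma XDBP_belyi_iter: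
  assumes f: "f \<in> XDBP" and n: "n > 0"
  shows "belyi (poly_iter n f)"
proof -
  have f': "degree f \<ge> 3" "poly f ` critical_points f \<subseteq> {0, 1}" "poly f 0 = 0" "poly f 1 = 0"
    using f by (auto simp: XDBP_def DBP_def)
  have "degree (poly_iter n f) = degree f ^ n"
    by (induction n) (simp_all add: poly_iter_simps degree_pcompose)
  moreover have "degree f ^ 1 \<le> degree f ^ n"
    using n f'(1) by (intro power_increasing) auto
  moreover have "poly (poly_iter n f) z \<in> {0, 1}" if "poly (pderiv (poly_iter n f)) z = 0" for z
    using that
  proof (induction n)
    \<comment> \<open>The zeroth iterate is \<open>[:0, 1:]\<close>, whose derivative has no zeros,
      so the induction can start at \<open>0\<close>.\<close>
    case 0
    then show ?case by (simp add: poly_iter_simps pderiv_pCons)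
  next
    case (Suc n)
    then have "poly (pderiv f) (poly (poly_iter n f) z) = 0 \<or> poly (pderiv (poly_iter n f)) z = 0"
      by (simp add: poly_iter_simps pderiv_pcompose poly_pcompose)
    then show ?case
    proof
      assume "poly (pderiv f) (poly (poly_iter n f) z) = 0"
      then show ?thesis
        using f'(2) by (auto simp: poly_iter_simps poly_pcompose critical_points_def)
    next
      assume "poly (pderiv (poly_iter n f)) z = 0"
      then show ?thesis
        using Suc.IH f'(3,4) by (auto simp: poly_iter_simps poly_pcompose)
    qed
  qed
  ultimately show ?thesis
    using f'(1) unfolding belyi_def critical_points_def by auto
qed

theorem theorem4p1:
  fixes f g :: "complex poly" and \<sigma> :: "complex \<Rightarrow> complex" and n :: nat
  assumes "f \<in> XDBP" and "g \<in> XDBP"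
    and "\<sigma> \<in> Gal_Qbar" and "g = map_poly \<sigma> f"
    and "n > 0"
  shows "perm_isomorphic
           (edges (poly_iter n f)) (Mon (poly_iter n f))
           (edges (poly_iter n g)) (Mon (poly_iter n g))"
proof -
  have f: "coeff f i \<in> Qbar" for i
    using assms(1) by (simp add: XDBP_def DBP_def)
  note iter = poly_iter_Gal[OF assms(3) f, of n]
  have g: "poly_iter n g = map_poly \<sigma> (poly_iter n f)"
    using iter(2) assms(4) by simp
  \<comment> \<open>For the conjugate this comes from \<open>g \<in> XDBP\<close>, since its
    iterates are the conjugates of those of \<open>f\<close>.\<close>
  have "belyi (map_poly \<sigma> (poly_iter n f))"
    using XDBP_belyi_iter[OF assms(2,5)] unfolding g .
  then show ?thesis
    unfolding g by (rule Mon_conjugate[OF assms(3) XDBP_belyi_iter[OF assms(1,5)] iter(1)])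
qed

end
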